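(* Let $p>3$ be prime, $\mathbb{F}=\mathbb{F}_{p^m}$, and $\Phi$ an irreducible root system of rank at least $2$. Let $S\subseteq\Phi$ be a subset of ${\mathrm{rank}}(\Phi)+1$ roots with $S^+=\Phi$. Then $X_S=E(\Phi,\mathbb{F})$.
   Context: Identify $\mathbb{F}$ with $\mathbb{F}_p[x]/(f)$ for a fixed irreducible $f$ of degree $m$; $\deg(t)$ for $t\in\mathbb{F}$ is the degree of its representative of degree $<m$. $E(\Phi,\mathbb{F})$ is the universal Chevalley group, generated by root elements $x_\alpha(t)$ ($\alpha\in\Phi$, $t\in\mathbb{F}$) subject to the Steinberg relations: $x_\alpha(t)x_\alpha(u)=x_\alpha(t+u)$; the Chevalley commutator formula $[x_\alpha(t),x_\beta(u)]=\prod_{i,j>0,\ i\alpha+j\beta\in\Phi}x_{i\alpha+j\beta}(C^{\alpha,\beta}_{ij}t^iu^j)$ for $\alpha+\beta\ne0$ with standard structure constants $C^{\alpha,\beta}_{ij}\in\{\pm1,\pm2,\pm3\}$; and $h_\alpha(t)h_\alpha(u)=h_\alpha(tu)$ where $h_\alpha(t)=n_\alpha(t)n_\alpha(-1)$, $n_\alpha(t)=x_\alpha(t)x_{-\alpha}(-t^{-1})x_\alpha(t)$. For $S\subseteq\Phi$, $X_S=\langle x_\alpha(t):\alpha\in S,\ t\in\mathbb{F},\ \deg(t)\le1\rangle$, and $S^+=\Phi\cap\{\sum_{\alpha\in S}n_\alpha\alpha:n_\alpha\in\mathbb{N}\}$. *)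

theory Defs
  imports
    "HOL-Analysis.Analysis"
    "HOL-Algebra.Generated_Groups"
    "HOL-Algebra.Ring"
    "Berlekamp_Zassenhaus.Finite_Field"
begin

section \<open>Root systems\<close>

definition coroot :: "'v::real_inner \<Rightarrow> 'v" where
  "coroot \<alpha> = (2 / (\<alpha> \<bullet> \<alpha>)) *\<^sub>R \<alpha>"

definition root_system :: "'v::euclidean_space set \<Rightarrow> bool" where
  "root_system \<Phi> \<longleftrightarrow>
     finite \<Phi> \<and> span \<Phi> = UNIV \<and> 0 \<notin> \<Phi> \<and>
     (\<forall>\<alpha>\<in>\<Phi>. \<forall>c. c *\<^sub>R \<alpha> \<in> \<Phi> \<longrightarrow> c = 1 \<or> c = -1) \<and>
     (\<forall>\<alpha>\<in>\<Phi>. \<forall>\<beta>\<in>\<Phi>. \<beta> - (\<beta> \<bullet> coroot \<alpha>) *\<^sub>R \<alpha> \<in> \<Phi>) \<and>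
     (\<forall>\<alpha>\<in>\<Phi>. \<forall>\<beta>\<in>\<Phi>. \<beta> \<bullet> coroot \<alpha> \<in> \<int>)"

definition irreducible_root_system :: "'v::euclidean_space set \<Rightarrow> bool" where
  "irreducible_root_system \<Phi> \<longleftrightarrow>
     root_system \<Phi> \<and> \<Phi> \<noteq> {} \<and>
     \<not> (\<exists>A B. A \<noteq> {} \<and> B \<noteq> {} \<and> A \<inter> B = {} \<and> A \<union> B = \<Phi> \<and>
          (\<forall>\<alpha>\<in>A. \<forall>\<beta>\<in>B. \<alpha> \<bullet> \<beta> = 0))"

definition root_rank :: "'v::euclidean_space set \<Rightarrow> nat" where
  "root_rank \<Phi> = dim (span \<Phi>)"

definition positive_closure :: "'v::euclidean_space set \<Rightarrow> 'v set \<Rightarrow> 'v set" where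
  "positive_closure \<Phi> S = \<Phi> \<inter> {\<Sum>\<alpha>\<in>S. real (n \<alpha>) *\<^sub>R \<alpha> | n :: 'v \<Rightarrow> nat. True}"


section \<open>Structure constants\<close>

text \<open>
  The split semisimple Lie algebra of \<open>\<Phi>\<close> with structure constants \<open>N\<close>: a pair \<open>(h, c)\<close> stands for
  \<open>h + (\<Sum>\<alpha>\<in>\<Phi>. c \<alpha> e\<^sub>\<alpha>)\<close>, where the Cartan subalgebra is identified with the ambient Euclidean space
  so that \<open>\<alpha>(h) = \<alpha> \<bullet> h\<close> and \<open>h\<^sub>\<alpha> = coroot \<alpha>\<close>. The bracket is the bilinear extension of
  \<open>[h, h'] = 0\<close>, \<open>[h, e\<^sub>\<alpha>] = \<alpha>(h) e\<^sub>\<alpha>\<close>, \<open>[e\<^sub>\<alpha>, e\<^sub>-\<^sub>\<alpha>] = h\<^sub>\<alpha>\<close>, \<open>[e\<^sub>\<alpha>, e\<^sub>\<beta>] = N\<^sub>\<alpha>\<^sub>\<beta> e\<^sub>\<alpha>\<^sub>+\<^sub>\<beta>\<close> if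
  \<open>\<alpha> + \<beta> \<in> \<Phi>\<close>, and \<open>[e\<^sub>\<alpha>, e\<^sub>\<beta>] = 0\<close> in all other cases.
\<close>

type_synonym 'v lie_elem = "'v \<times> ('v \<Rightarrow> real)"

definition lie_carrier :: "'v::euclidean_space set \<Rightarrow> 'v lie_elem set" where
  "lie_carrier \<Phi> = {(h, c). \<forall>\<alpha>. \<alpha> \<notin> \<Phi> \<longrightarrow> c \<alpha> = 0}"

definition lie_bracket ::
  "'v::euclidean_space set \<Rightarrow> ('v \<Rightarrow> 'v \<Rightarrow> int) \<Rightarrow> 'v lie_elem \<Rightarrow> 'v lie_elem \<Rightarrow> 'v lie_elem" where
  "lie_bracket \<Phi> N = (\<lambda>(h, c) (h', c').
     (\<Sum>\<alpha>\<in>\<Phi>. (c \<alpha> * c' (- \<alpha>)) *\<^sub>R coroot \<alpha>,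
      \<lambda>\<gamma>. if \<gamma> \<in> \<Phi>
           then (\<gamma> \<bullet> h) * c' \<gamma> - (\<gamma> \<bullet> h') * c \<gamma> +
                (\<Sum>\<alpha>\<in>{\<alpha>\<in>\<Phi>. \<gamma> - \<alpha> \<in> \<Phi>}. of_int (N \<alpha> (\<gamma> - \<alpha>)) * c \<alpha> * c' (\<gamma> - \<alpha>))
           else 0))"

definition lie_add :: "'v::euclidean_space lie_elem \<Rightarrow> 'v lie_elem \<Rightarrow> 'v lie_elem" where
  "lie_add = (\<lambda>(h, c) (h', c'). (h + h', \<lambda>\<alpha>. c \<alpha> + c' \<alpha>))"

definition lie_zero :: "'v::euclidean_space lie_elem" where
  "lie_zero = (0, \<lambda>\<alpha>. 0)"

text \<open>
  \<open>N\<close> is the family of structure constants of a Chevalley basis. The normalisation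
  \<open>N\<^sub>\<alpha>\<^sub>\<beta> = \<plusminus>(p + 1)\<close>, where \<open>\<beta> - p\<alpha>, \<dots>, \<beta>, \<dots>\<close> is the \<open>\<alpha>\<close>-string through \<open>\<beta>\<close>, is
  part of Chevalley's basis theorem. Only the values of \<open>N\<close> at pairs of roots whose sum is a root
  matter.
\<close>

definition chevalley_constants :: "'v::euclidean_space set \<Rightarrow> ('v \<Rightarrow> 'v \<Rightarrow> int) \<Rightarrow> bool" where
  "chevalley_constants \<Phi> N \<longleftrightarrow>
     (\<forall>x\<in>lie_carrier \<Phi>. lie_bracket \<Phi> N x x = lie_zero) \<and>
     (\<forall>x\<in>lie_carrier \<Phi>. \<forall>y\<in>lie_carrier \<Phi>. \<forall>z\<in>lie_carrier \<Phi>.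
        lie_add (lie_bracket \<Phi> N x (lie_bracket \<Phi> N y z))
          (lie_add (lie_bracket \<Phi> N y (lie_bracket \<Phi> N z x))
                   (lie_bracket \<Phi> N z (lie_bracket \<Phi> N x y))) = lie_zero) \<and>
     (\<forall>\<alpha>\<in>\<Phi>. \<forall>\<beta>\<in>\<Phi>. \<alpha> + \<beta> \<in> \<Phi> \<longrightarrow>
        N (- \<alpha>) (- \<beta>) = - N \<alpha> \<beta> \<and>
        \<bar>N \<alpha> \<beta>\<bar> = int (GREATEST p. \<beta> - real p *\<^sub>R \<alpha> \<in> \<Phi>) + 1)"

text \<open>\<open>M\<^sub>\<alpha>\<^sub>,\<^sub>\<beta>\<^sub>,\<^sub>i\<close> is defined by \<open>(ad e\<^sub>\<alpha>)\<^sup>i / i! e\<^sub>\<beta> = M\<^sub>\<alpha>\<^sub>,\<^sub>\<beta>\<^sub>,\<^sub>i e\<^sub>i\<^sub>\<alpha>\<^sub>+\<^sub>\<beta>\<close>; the division is exact.\<close>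

definition string_const ::
  "('v::real_vector \<Rightarrow> 'v \<Rightarrow> int) \<Rightarrow> 'v \<Rightarrow> 'v \<Rightarrow> nat \<Rightarrow> int" where
  "string_const N \<alpha> \<beta> i = (\<Prod>k<i. N \<alpha> (\<beta> + real k *\<^sub>R \<alpha>)) div fact i"

text \<open>
  The constants \<open>C\<^sup>\<alpha>\<^sup>,\<^sup>\<beta>\<^sub>i\<^sub>j\<close> of the commutator formula for the commutator
  \<open>[g, h] = g h g\<^sup>-\<^sup>1 h\<^sup>-\<^sup>1\<close> and factors ordered by increasing \<open>i + j\<close>; see Carter, ``Simple Groups of
  Lie Type'', Theorem 5.2.2. Carter states the formula for \<open>g\<^sup>-\<^sup>1 h\<^sup>-\<^sup>1 g h\<close> with parameters
  \<open>C\<^sub>i\<^sub>j\<^sub>r\<^sub>s (-t)\<^sup>i u\<^sup>j\<close> for \<open>[x\<^sub>s(u), x\<^sub>r(t)]\<close>, so \<open>C\<^sup>\<alpha>\<^sup>,\<^sup>\<beta>\<^sub>i\<^sub>j\<close> here is his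
  \<open>(-1)\<^sup>i C\<^sub>j\<^sub>i\<^sub>\<beta>\<^sub>\<alpha>\<close>. If \<open>i, j > 0\<close> and \<open>i\<alpha> + j\<beta>\<close> is a root then \<open>i = 1\<close> or \<open>j = 1\<close> or
  \<open>(i, j) \<in> {(3, 2), (2, 3)}\<close>, and the divisions by 3 are exact.
\<close>

definition comm_const ::
  "('v::real_vector \<Rightarrow> 'v \<Rightarrow> int) \<Rightarrow> 'v \<Rightarrow> 'v \<Rightarrow> nat \<Rightarrow> nat \<Rightarrow> int" where
  "comm_const N \<alpha> \<beta> i j =
     (if j = 1 then string_const N \<alpha> \<beta> i
      else if i = 1 then - string_const N \<beta> \<alpha> j
      else if i = 3 \<and> j = 2 then (2 * string_const N (\<alpha> + \<beta>) \<alpha> 2) div 3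
      else if i = 2 \<and> j = 3 then string_const N (\<alpha> + \<beta>) \<beta> 2 div 3
      else 0)"


section \<open>Groups given by generators and relations\<close>

text \<open>Words in generators and formal inverses: \<open>(g, True)\<close> is the generator \<open>g\<close> and \<open>(g, False)\<close> its
  inverse. A relation \<open>l = r\<close> is a pair \<open>(l, r)\<close> of words.\<close>

type_synonym 'g gword = "('g \<times> bool) list"

definition gwords :: "'g set \<Rightarrow> 'g gword set" where
  "gwords X = lists (X \<times> UNIV)"

definition winv :: "'g gword \<Rightarrow> 'g gword" where
  "winv w = rev (map (\<lambda>(g, b). (g, \<not> b)) w)"

definition wcomm :: "'g gword \<Rightarrow> 'g gword \<Rightarrow> 'g gword" where
  "wcomm v w = v @ w @ winv v @ winv w"

inductive_set word_eq :: "'g set \<Rightarrow> ('g gword \<times> 'g gword) set \<Rightarrow> ('g gword \<times> 'g gword) set"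
  for X :: "'g set" and R :: "('g gword \<times> 'g gword) set" where
  refl: "w \<in> gwords X \<Longrightarrow> (w, w) \<in> word_eq X R"
| sym: "(v, w) \<in> word_eq X R \<Longrightarrow> (w, v) \<in> word_eq X R"
| trans: "(u, v) \<in> word_eq X R \<Longrightarrow> (v, w) \<in> word_eq X R \<Longrightarrow> (u, w) \<in> word_eq X R"
| cancel: "v \<in> gwords X \<Longrightarrow> w \<in> gwords X \<Longrightarrow> g \<in> X \<Longrightarrow>
    (v @ [(g, b), (g, \<not> b)] @ w, v @ w) \<in> word_eq X R"
| relation: "v \<in> gwords X \<Longrightarrow> w \<in> gwords X \<Longrightarrow> (l, r) \<in> R \<Longrightarrow> l \<in> gwords X \<Longrightarrow> r \<in> gwords X \<Longrightarrow>
    (v @ l @ w, v @ r @ w) \<in> word_eq X R"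

definition presented_group ::
  "'g set \<Rightarrow> ('g gword \<times> 'g gword) set \<Rightarrow> 'g gword set monoid" where
  "presented_group X R =
     \<lparr>carrier = gwords X // word_eq X R,
      mult = (\<lambda>A B. \<Union>v\<in>A. \<Union>w\<in>B. word_eq X R `` {v @ w}),
      one = word_eq X R `` {[]}\<rparr>"


section \<open>The universal Chevalley group\<close>

definition xw :: "'v \<Rightarrow> 'a \<Rightarrow> ('v \<times> 'a) gword" where
  "xw \<alpha> t = [((\<alpha>, t), True)]"

definition nw :: "('a, 'm) ring_scheme \<Rightarrow> 'v::uminus \<Rightarrow> 'a \<Rightarrow> ('v \<times> 'a) gword" where
  "nw F \<alpha> t = xw \<alpha> t @ xw (- \<alpha>) (\<ominus>\<^bsub>F\<^esub> (inv\<^bsub>F\<^esub> t)) @ xw \<alpha> t"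

definition hw :: "('a, 'm) ring_scheme \<Rightarrow> 'v::uminus \<Rightarrow> 'a \<Rightarrow> ('v \<times> 'a) gword" where
  "hw F \<alpha> t = nw F \<alpha> t @ nw F \<alpha> (\<ominus>\<^bsub>F\<^esub> \<one>\<^bsub>F\<^esub>)"

text \<open>
  In the commutator formula, factors with equal \<open>i + j\<close> commute, so it does not matter that \<open>ijs\<close> is
  only determined up to their order.
\<close>

inductive_set steinberg_relations ::
  "'v::euclidean_space set \<Rightarrow> ('v \<Rightarrow> 'v \<Rightarrow> int) \<Rightarrow> ('a, 'm) ring_scheme
     \<Rightarrow> (('v \<times> 'a) gword \<times> ('v \<times> 'a) gword) set"
  for \<Phi> :: "'v set" and N :: "'v \<Rightarrow> 'v \<Rightarrow> int" and F :: "('a, 'm) ring_scheme" where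
  additive: "\<alpha> \<in> \<Phi> \<Longrightarrow> t \<in> carrier F \<Longrightarrow> u \<in> carrier F \<Longrightarrow>
    (xw \<alpha> t @ xw \<alpha> u, xw \<alpha> (t \<oplus>\<^bsub>F\<^esub> u)) \<in> steinberg_relations \<Phi> N F"
| commutator: "\<alpha> \<in> \<Phi> \<Longrightarrow> \<beta> \<in> \<Phi> \<Longrightarrow> \<alpha> + \<beta> \<noteq> 0 \<Longrightarrow> t \<in> carrier F \<Longrightarrow> u \<in> carrier F \<Longrightarrow>
    distinct ijs \<Longrightarrow> sorted (map (\<lambda>(i, j). i + j) ijs) \<Longrightarrow>
    set ijs = {(i, j). i > 0 \<and> j > 0 \<and> real i *\<^sub>R \<alpha> + real j *\<^sub>R \<beta> \<in> \<Phi>} \<Longrightarrow>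
    (wcomm (xw \<alpha> t) (xw \<beta> u),
     concat (map (\<lambda>(i, j). xw (real i *\<^sub>R \<alpha> + real j *\<^sub>R \<beta>)
       (add_pow F (comm_const N \<alpha> \<beta> i j) (t [^]\<^bsub>F\<^esub> i \<otimes>\<^bsub>F\<^esub> u [^]\<^bsub>F\<^esub> j))) ijs))
    \<in> steinberg_relations \<Phi> N F"
| multiplicative: "\<alpha> \<in> \<Phi> \<Longrightarrow> t \<in> carrier F - {\<zero>\<^bsub>F\<^esub>} \<Longrightarrow> u \<in> carrier F - {\<zero>\<^bsub>F\<^esub>} \<Longrightarrow>
    (hw F \<alpha> t @ hw F \<alpha> u, hw F \<alpha> (t \<otimes>\<^bsub>F\<^esub> u)) \<in> steinberg_relations \<Phi> N F"

definition chevalley_group ::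
  "'v::euclidean_space set \<Rightarrow> ('v \<Rightarrow> 'v \<Rightarrow> int) \<Rightarrow> ('a, 'm) ring_scheme \<Rightarrow> ('v \<times> 'a) gword set monoid" where
  "chevalley_group \<Phi> N F = presented_group (\<Phi> \<times> carrier F) (steinberg_relations \<Phi> N F)"

definition root_elem ::
  "'v::euclidean_space set \<Rightarrow> ('v \<Rightarrow> 'v \<Rightarrow> int) \<Rightarrow> ('a, 'm) ring_scheme
     \<Rightarrow> 'v \<Rightarrow> 'a \<Rightarrow> ('v \<times> 'a) gword set" where
  "root_elem \<Phi> N F \<alpha> t = word_eq (\<Phi> \<times> carrier F) (steinberg_relations \<Phi> N F) `` {xw \<alpha> t}"


section \<open>The field of residues modulo an irreducible polynomial\<close>

text \<open>For irreducible \<open>f\<close>, this is the field of polynomials modulo \<open>f\<close>, each class being represented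
  by its element of degree less than that of \<open>f\<close>.\<close>

definition poly_residue_ring :: "'p::prime_card mod_ring poly \<Rightarrow> 'p mod_ring poly ring" where
  "poly_residue_ring f =
     \<lparr>carrier = {t. degree t < degree f},
      mult = (\<lambda>t u. (t * u) mod f), one = 1, zero = 0, add = (+)\<rparr>"

definition X_sub ::
  "'v::euclidean_space set \<Rightarrow> ('v \<Rightarrow> 'v \<Rightarrow> int) \<Rightarrow> 'p::prime_card mod_ring poly \<Rightarrow> 'v set
     \<Rightarrow> ('v \<times> 'p mod_ring poly) gword set set" where
  "X_sub \<Phi> N f S =
     generate (chevalley_group \<Phi> N (poly_residue_ring f))
       {root_elem \<Phi> N (poly_residue_ring f) \<alpha> t | \<alpha> t.
          \<alpha> \<in> S \<and> t \<in> carrier (poly_residue_ring f) \<and> degree t \<le> 1}"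

end

theory Submission
  imports Defs
begin

text \<open>
  Let \<open>H\<close> be the subgroup \<open>X\<^sub>S\<close>. The key step is that \<open>x\<^sub>\<alpha>(t), x\<^sub>\<beta>(u) \<in> H\<close> and \<open>\<alpha> + \<beta> \<in> \<Phi>\<close> imply
  \<open>x\<^sub>\<alpha>\<^sub>+\<^sub>\<beta>(tu) \<in> H\<close>: the unwanted factors of the commutator formula are removed by combining the
  formula for \<open>(t, u)\<close> with those for multiples of \<open>t\<close> and \<open>u\<close> by integers, and the remaining integer
  coefficient is invertible since \<open>p > 3\<close>. As \<open>S\<^sup>+ = \<Phi>\<close>, every root is obtained from \<open>S\<close> by successively
  adding elements of \<open>S\<close> such that all partial sums are roots; hence \<open>x\<^sub>\<gamma>(1)\<close> and \<open>x\<^sub>\<gamma>(X)\<close> lie in \<open>H\<close>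
  for every root \<open>\<gamma>\<close>, where \<open>X\<close> is the indeterminate. Since every root is a sum of two roots, the
  set of all \<open>t\<close> such that \<open>x\<^sub>\<gamma>(t) \<in> H\<close> for all \<open>\<gamma>\<close> is a subring. It contains \<open>1\<close> and \<open>X\<close>, so it
  is the whole field.
\<close>

section \<open>Root systems\<close>

lemma root_system_uminus:
  assumes "root_system \<Phi>" "\<alpha> \<in> \<Phi>" shows "- \<alpha> \<in> \<Phi>"
proof -
  have "\<alpha> \<noteq> 0" using assms by (auto simp: root_system_def)
  hence "\<alpha> \<bullet> coroot \<alpha> = 2" by (simp add: coroot_def)
  moreover have "\<alpha> - (\<alpha> \<bullet> coroot \<alpha>) *\<^sub>R \<alpha> \<in> \<Phi>" using assms by (auto simp: root_system_def)
  ultimately show ?thesis by (simp add: scaleR_2)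
qed

lemma root_inner_pos:
  assumes "root_system \<Phi>" "\<alpha> \<in> \<Phi>" shows "\<alpha> \<bullet> \<alpha> > 0"
  using assms by (auto simp: root_system_def)

section \<open>Cartan integers\<close>

lemma cartan_integer:
  assumes "root_system \<Phi>" "\<alpha> \<in> \<Phi>" "\<beta> \<in> \<Phi>"
  obtains n :: int where "2 * (\<alpha> \<bullet> \<beta>) = n * (\<alpha> \<bullet> \<alpha>)"
proof -
  have "\<beta> \<bullet> coroot \<alpha> \<in> \<int>" using assms by (auto simp: root_system_def)
  then obtain n where "\<beta> \<bullet> coroot \<alpha> = of_int n" by (auto elim: Ints_cases)
  thus ?thesis using that[of n] root_inner_pos[OF assms(1,2)]
    by (simp add: coroot_def field_simps inner_commute)
qed

lemma reflection_mem:
  assumes "root_system \<Phi>" "\<alpha> \<in> \<Phi>" "\<beta> \<in> \<Phi>" "2 * (\<alpha> \<bullet> \<beta>) = n * (\<alpha> \<bullet> \<alpha>)"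
  shows "\<beta> - n *\<^sub>R \<alpha> \<in> \<Phi>"
proof -
  have "\<beta> \<bullet> coroot \<alpha> = n" using assms(4) root_inner_pos[OF assms(1,2)]
    by (simp add: coroot_def field_simps inner_commute)
  thus ?thesis using assms by (auto simp: root_system_def)
qed

text \<open>Equality in Cauchy-Schwarz would make the two roots proportional, and by reducedness
  only \<alpha> and its negative lie on the line through \<alpha>.\<close>

lemma roots_inner_square_less:
  assumes "root_system \<Phi>" "\<alpha> \<in> \<Phi>" "\<beta> \<in> \<Phi>" "\<beta> \<noteq> \<alpha>" "\<beta> \<noteq> - \<alpha>"
  shows "(\<alpha> \<bullet> \<beta>)\<^sup>2 < (\<alpha> \<bullet> \<alpha>) * (\<beta> \<bullet> \<beta>)"
proof (rule ccontr)
  assume "\<not> ?thesis"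
  hence "(\<alpha> \<bullet> \<beta>)\<^sup>2 = (\<alpha> \<bullet> \<alpha>) * (\<beta> \<bullet> \<beta>)"
    using Cauchy_Schwarz_ineq[of \<alpha> \<beta>] by (simp add: power2_eq_square)
  hence "\<bar>\<alpha> \<bullet> \<beta>\<bar>\<^sup>2 = (norm \<alpha> * norm \<beta>)\<^sup>2" by (simp add: power_mult_distrib dot_square_norm)
  hence "\<bar>\<alpha> \<bullet> \<beta>\<bar> = norm \<alpha> * norm \<beta>" by (simp only: power2_eq_iff_nonneg abs_ge_zero mult_nonneg_nonneg norm_ge_zero)
  hence *: "norm \<alpha> *\<^sub>R \<beta> = norm \<beta> *\<^sub>R \<alpha> \<or> norm \<alpha> *\<^sub>R \<beta> = - norm \<beta> *\<^sub>R \<alpha>"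
    by (simp add: norm_cauchy_schwarz_abs_eq)
  have nz: "norm \<alpha> \<noteq> 0" using assms by (auto simp: root_system_def)
  have "\<exists>c. \<beta> = c *\<^sub>R \<alpha>"
  proof -
    have "\<beta> = (1 / norm \<alpha>) *\<^sub>R (norm \<alpha> *\<^sub>R \<beta>)" using nz by simp
    thus ?thesis using * by (metis scaleR_scaleR)
  qed
  then obtain c where c: "\<beta> = c *\<^sub>R \<alpha>" ..
  hence "c = 1 \<or> c = -1" using assms by (auto simp: root_system_def)
  thus False using c assms by auto
qed

text \<open>The product of the two Cartan integers is four times the squared cosine of the angle,
  which is below 4 by strict Cauchy-Schwarz.\<close>

lemma cartan_integers_product:
  assumes "root_system \<Phi>" "\<alpha> \<in> \<Phi>" "\<beta> \<in> \<Phi>" "\<beta> \<noteq> \<alpha>" "\<beta> \<noteq> - \<alpha>"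
    and m: "2 * (\<alpha> \<bullet> \<beta>) = of_int m * (\<alpha> \<bullet> \<alpha>)" and n: "2 * (\<alpha> \<bullet> \<beta>) = of_int n * (\<beta> \<bullet> \<beta>)"
  shows "0 \<le> m * n" "m * n \<le> 3"
proof -
  let ?P = "(\<alpha> \<bullet> \<alpha>) * (\<beta> \<bullet> \<beta>)"
  have P: "?P > 0" using root_inner_pos assms by (metis mult_pos_pos)
  have "of_int (m * n) * ?P = (2 * (\<alpha> \<bullet> \<beta>)) * (2 * (\<alpha> \<bullet> \<beta>))"
    by (subst (1) m, subst n) (simp add: algebra_simps)
  hence eq: "of_int (m * n) * ?P = 4 * (\<alpha> \<bullet> \<beta>)\<^sup>2" by (simp add: power2_eq_square)
  hence "of_int (m * n) * ?P < 4 * ?P" using roots_inner_square_less[OF assms(1-5)] by simp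
  hence "of_int (m * n) < (4::real)" using P by (simp only: mult_less_cancel_right_pos)
  thus "m * n \<le> 3" by linarith
  have "0 \<le> of_int (m * n) * ?P" by (simp only: eq) simp
  hence "0 \<le> real_of_int (m * n)" using P by (metis mult_neg_pos not_le)
  thus "0 \<le> m * n" by linarith
qed

lemma cartan_integer_abs_le:
  assumes "root_system \<Phi>" "\<alpha> \<in> \<Phi>" "\<beta> \<in> \<Phi>" "\<beta> \<noteq> \<alpha>" "\<beta> \<noteq> - \<alpha>"
    and m: "2 * (\<alpha> \<bullet> \<beta>) = of_int m * (\<alpha> \<bullet> \<alpha>)"
  shows "\<bar>m\<bar> \<le> 3"
proof -
  obtain n :: int where n: "2 * (\<beta> \<bullet> \<alpha>) = n * (\<beta> \<bullet> \<beta>)" using cartan_integer assms(1-3) by metis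
  note mn = cartan_integers_product[OF assms n[unfolded inner_commute[of \<beta> \<alpha>]]]
  show ?thesis
  proof (cases "n = 0")
    case True
    hence "m = 0" using m n root_inner_pos[OF assms(1,2)] by (simp add: inner_commute)
    thus ?thesis by simp
  next
    case False
    have "\<bar>m\<bar> * 1 \<le> \<bar>m\<bar> * \<bar>n\<bar>" using False by (intro mult_left_mono) auto
    also have "\<dots> \<le> 3" using mn by (simp add: abs_mult[symmetric])
    finally show ?thesis by simp
  qed
qed

text \<open>Both Cartan integers are positive with product at most 3, so one of them is 1; the
  corresponding reflection subtracts one root from the other exactly once.\<close>

lemma root_diff_mem:
  assumes rs: "root_system \<Phi>" "\<alpha> \<in> \<Phi>" "\<beta> \<in> \<Phi>" and pos: "\<alpha> \<bullet> \<beta> > 0" and ne: "\<alpha> \<noteq> \<beta>"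
  shows "\<alpha> - \<beta> \<in> \<Phi>"
proof -
  have ne': "\<beta> \<noteq> - \<alpha>" 
  proof
    assume "\<beta> = - \<alpha>"
    hence "\<alpha> \<bullet> \<alpha> < 0" using pos by simp
    thus False using inner_ge_zero[of \<alpha>] by linarith
  qed
  obtain m :: int where m: "2 * (\<alpha> \<bullet> \<beta>) = m * (\<alpha> \<bullet> \<alpha>)" using cartan_integer rs by metis
  obtain n :: int where n: "2 * (\<beta> \<bullet> \<alpha>) = n * (\<beta> \<bullet> \<beta>)" using cartan_integer rs by metis
  note mn = cartan_integers_product[OF rs ne[symmetric] ne' m n[unfolded inner_commute[of \<beta> \<alpha>]]]
  have "0 < of_int m * (\<alpha> \<bullet> \<alpha>)" "0 < of_int n * (\<beta> \<bullet> \<beta>)" using m n pos by (auto simp: inner_commute)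
  hence "0 < real_of_int m" "0 < real_of_int n"
    using root_inner_pos rs by (meson zero_less_mult_pos2)+
  hence pm: "m > 0" "n > 0" by auto
  have "m = 1 \<or> n = 1"
  proof (rule ccontr)
    assume "\<not> ?thesis"
    hence "2 * 2 \<le> m * n" using pm by (intro mult_mono) auto
    thus False using mn by simp
  qed
  thus ?thesis
  proof
    assume "n = 1"
    thus ?thesis using reflection_mem[OF rs(1,3,2) n] by simp
  next
    assume "m = 1"
    hence "\<beta> - \<alpha> \<in> \<Phi>" using reflection_mem[OF rs m] by simp
    thus ?thesis using root_system_uminus[OF rs(1)] by fastforce
  qed
qed

text \<open>Irreducibility and rank at least 2 provide a further root not orthogonal to \<gamma>.
  After a change of sign its inner product with \<gamma> is positive, so it can be
  subtracted.\<close>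

lemma root_sum_of_roots:
  assumes irr: "irreducible_root_system \<Phi>" and rank: "root_rank \<Phi> \<ge> 2" and g: "\<gamma> \<in> \<Phi>"
  obtains \<alpha> \<beta> where "\<alpha> \<in> \<Phi>" "\<beta> \<in> \<Phi>" "\<gamma> = \<alpha> + \<beta>"
proof -
  have rs: "root_system \<Phi>" using irr by (simp add: irreducible_root_system_def)
  let ?A = "{\<gamma>, - \<gamma>}"
  have sub: "?A \<subseteq> \<Phi>" using g root_system_uminus[OF rs] by auto
  have "\<not> \<Phi> \<subseteq> ?A"
  proof
    assume "\<Phi> \<subseteq> ?A"
    hence "\<Phi> \<subseteq> span {\<gamma>}" using span_base[of \<gamma> "{\<gamma>}"] span_neg[of \<gamma> "{\<gamma>}"] by auto
    hence "dim \<Phi> \<le> 1" using dim_le_card[of \<Phi> "{\<gamma>}"] by simp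
    thus False using rank by (simp add: root_rank_def)
  qed
  hence "\<exists>\<delta>\<in>\<Phi> - ?A. \<gamma> \<bullet> \<delta> \<noteq> 0"
  proof (rule contrapos_pp)
    assume "\<not> (\<exists>\<delta>\<in>\<Phi> - ?A. \<gamma> \<bullet> \<delta> \<noteq> 0)"
    hence "\<forall>\<alpha>\<in>?A. \<forall>\<beta>\<in>\<Phi> - ?A. \<alpha> \<bullet> \<beta> = 0" by auto
    moreover have "?A \<noteq> {}" "?A \<inter> (\<Phi> - ?A) = {}" "?A \<union> (\<Phi> - ?A) = \<Phi>" using sub by auto
    ultimately have "\<Phi> - ?A = {}" using irr unfolding irreducible_root_system_def by metis
    thus "\<not> \<not> \<Phi> \<subseteq> ?A" by blast
  qed
  then obtain \<delta> where d: "\<delta> \<in> \<Phi>" "\<delta> \<noteq> \<gamma>" "\<delta> \<noteq> - \<gamma>" "\<gamma> \<bullet> \<delta> \<noteq> 0" by auto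
  have "\<exists>\<delta>\<in>\<Phi>. \<gamma> \<bullet> \<delta> > 0 \<and> \<gamma> \<noteq> \<delta>"
  proof (cases "\<gamma> \<bullet> \<delta> > 0")
    case False
    hence "\<gamma> \<bullet> - \<delta> > 0" "- \<delta> \<noteq> \<gamma>" using d by auto
    thus ?thesis using root_system_uminus[OF rs d(1)] by metis
  qed (use d in auto)
  then obtain \<delta> where "\<delta> \<in> \<Phi>" "\<gamma> \<bullet> \<delta> > 0" "\<gamma> \<noteq> \<delta>" by auto
  thus ?thesis using that[of "\<gamma> - \<delta>" \<delta>] root_diff_mem[OF rs g] by simp
qed

text \<open>A root \<open>\<gamma>\<close> has positive inner product with some term \<open>\<beta>\<close> of an expression of \<open>\<gamma>\<close> as a sum
  over \<open>S\<close>, and \<open>\<gamma> - \<beta>\<close> is then zero or a root with a shorter expression.\<close>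

lemma positive_closure_induct [consumes 4, case_names base step]:
  assumes rs: "root_system \<Phi>" and S: "S \<subseteq> \<Phi>" and cl: "positive_closure \<Phi> S = \<Phi>" and g: "\<gamma> \<in> \<Phi>"
    and base: "\<And>\<beta>. \<beta> \<in> S \<Longrightarrow> P \<beta>"
    and step: "\<And>\<alpha> \<beta>. \<alpha> \<in> \<Phi> \<Longrightarrow> P \<alpha> \<Longrightarrow> \<beta> \<in> S \<Longrightarrow> \<alpha> + \<beta> \<in> \<Phi> \<Longrightarrow> P (\<alpha> + \<beta>)"
  shows "P \<gamma>"
proof -
  have fin: "finite S" using rs S finite_subset by (auto simp: root_system_def)
  have *: "P \<gamma>" if "\<gamma> \<in> \<Phi>" "\<gamma> = (\<Sum>\<alpha>\<in>S. real (n \<alpha>) *\<^sub>R \<alpha>)" for n \<gamma>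
    using that
  proof (induction "\<Sum>\<alpha>\<in>S. n \<alpha>" arbitrary: n \<gamma> rule: less_induct)
    case less
    have "\<gamma> \<bullet> \<gamma> = (\<Sum>\<alpha>\<in>S. n \<alpha> * (\<gamma> \<bullet> \<alpha>))"
      by (subst (2) less.prems(2)) (simp add: inner_sum_right)
    hence "(\<Sum>\<alpha>\<in>S. n \<alpha> * (\<gamma> \<bullet> \<alpha>)) > 0" using root_inner_pos[OF rs less.prems(1)] by simp
    then obtain \<beta> where b: "\<beta> \<in> S" "n \<beta> * (\<gamma> \<bullet> \<beta>) > 0" by (meson not_le sum_nonpos)
    hence pos: "\<gamma> \<bullet> \<beta> > 0" "n \<beta> > 0" by (auto simp: zero_less_mult_iff)
    show ?case
    proof (cases "\<gamma> = \<beta>")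
      case True
      thus ?thesis using base b by simp
    next
      case False
      \<comment> \<open>The coefficient of \<beta> is positive, so this natural-number subtraction
        really lowers the total by one.\<close>
      let ?n = "n(\<beta> := n \<beta> - 1)"
      have d: "\<gamma> - \<beta> \<in> \<Phi>" using root_diff_mem[OF rs less.prems(1) _ pos(1) False] S b by auto
      have "(\<Sum>\<alpha>\<in>S. real (n \<alpha>) *\<^sub>R \<alpha>) = n \<beta> *\<^sub>R \<beta> + (\<Sum>\<alpha>\<in>S - {\<beta>}. real (n \<alpha>) *\<^sub>R \<alpha>)"
        using fin b by (simp add: sum.remove)
      moreover have "(\<Sum>\<alpha>\<in>S. real (?n \<alpha>) *\<^sub>R \<alpha>) = ?n \<beta> *\<^sub>R \<beta> + (\<Sum>\<alpha>\<in>S - {\<beta>}. real (?n \<alpha>) *\<^sub>R \<alpha>)"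
        using fin b by (subst sum.remove) auto
      moreover have "(\<Sum>\<alpha>\<in>S - {\<beta>}. real (?n \<alpha>) *\<^sub>R \<alpha>) = (\<Sum>\<alpha>\<in>S - {\<beta>}. real (n \<alpha>) *\<^sub>R \<alpha>)"
        by (rule sum.cong) auto
      ultimately have eq: "\<gamma> - \<beta> = (\<Sum>\<alpha>\<in>S. real (?n \<alpha>) *\<^sub>R \<alpha>)"
        using less.prems(2) pos by (simp add: of_nat_diff algebra_simps)
      have "(\<Sum>\<alpha>\<in>S. ?n \<alpha>) < (\<Sum>\<alpha>\<in>S. n \<alpha>)"
        using fin b pos by (intro sum_strict_mono_ex1) auto
      note IH = less.hyps[OF this d eq]
      have "P (\<gamma> - \<beta> + \<beta>)" by (rule step[OF d IH b(1)]) (simp add: less.prems(1))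
      thus ?thesis by simp
    qed
  qed
  have "\<gamma> \<in> positive_closure \<Phi> S" using cl g by simp
  thus ?thesis using * by (auto simp: positive_closure_def)
qed

section \<open>Index pairs of the commutator formula in rank two\<close>

lemma roots_not_proportional:
  assumes rs: "root_system \<Phi>" and ab: "\<alpha> \<in> \<Phi>" "\<beta> \<in> \<Phi>" "\<alpha> + \<beta> \<in> \<Phi>"
  shows "\<beta> \<noteq> c *\<^sub>R \<alpha>"
proof
  assume c: "\<beta> = c *\<^sub>R \<alpha>"
  hence "(1 + c) *\<^sub>R \<alpha> \<in> \<Phi>" using ab by (simp add: scaleR_add_left)
  hence "1 + c = 1 \<or> 1 + c = -1" using rs ab unfolding root_system_def by blast
  moreover have "c = 1 \<or> c = -1" using c rs ab unfolding root_system_def by blast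
  ultimately show False by auto
qed

text \<open>The shorter root serves as unit of length: \<open>k\<close> is the ratio of squared
  lengths and \<open>b\<close> a Cartan integer. The first three pairs are roots of equal length at
  60, 90 and 120 degrees, the last two are configurations of simple roots in types B2 and
  G2.\<close>

lemma rank_two_forms:
  assumes rs: "root_system \<Phi>" "\<alpha> \<in> \<Phi>" "\<beta> \<in> \<Phi>" and sum: "\<alpha> + \<beta> \<in> \<Phi>" and le: "\<alpha> \<bullet> \<alpha> \<le> \<beta> \<bullet> \<beta>"
  obtains k b :: int where "2 * (\<alpha> \<bullet> \<beta>) = b * (\<alpha> \<bullet> \<alpha>)" "\<beta> \<bullet> \<beta> = k * (\<alpha> \<bullet> \<alpha>)"
    "(k, b) \<in> {(1, 1), (1, 0), (1, -1), (2, -2), (3, -3)}"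
proof -
  let ?a = "\<alpha> \<bullet> \<alpha>"
  have pa: "?a > 0" and pb: "\<beta> \<bullet> \<beta> > 0" using root_inner_pos rs by auto
  have ne: "\<beta> \<noteq> \<alpha>" using roots_not_proportional[OF rs sum, of 1] by simp
  have ne': "\<beta> \<noteq> - \<alpha>" using rs sum by (auto simp: root_system_def)
  obtain b :: int where b: "2 * (\<alpha> \<bullet> \<beta>) = b * ?a" using cartan_integer rs by metis
  obtain c :: int where "2 * (\<beta> \<bullet> \<alpha>) = c * (\<beta> \<bullet> \<beta>)" using cartan_integer rs by metis
  hence c: "2 * (\<alpha> \<bullet> \<beta>) = c * (\<beta> \<bullet> \<beta>)" by (simp add: inner_commute)
  note bc = cartan_integers_product[OF rs ne ne' b c]
  \<comment> \<open>Integrality of this Cartan integer relative to the root \<alpha> + \<beta>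
    forces equal lengths for orthogonal roots and excludes \<open>b = 2\<close> and
    \<open>b = 3\<close>.\<close>
  obtain m :: int where "2 * ((\<alpha> + \<beta>) \<bullet> \<alpha>) = m * ((\<alpha> + \<beta>) \<bullet> (\<alpha> + \<beta>))"
    using cartan_integer rs sum by metis
  hence m: "2 * ?a + 2 * (\<alpha> \<bullet> \<beta>) = m * (?a + 2 * (\<alpha> \<bullet> \<beta>) + \<beta> \<bullet> \<beta>)"
    by (simp add: inner_add inner_commute algebra_simps)
  show ?thesis
  proof (cases "b = 0")
    case True
    hence ab: "\<alpha> \<bullet> \<beta> = 0" using b by simp
    with m have m': "2 * ?a = m * (?a + \<beta> \<bullet> \<beta>)" by simp
    hence "0 < m * (?a + \<beta> \<bullet> \<beta>)" using pa by linarith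
    hence mp: "m > 0" using pa pb by (simp add: zero_less_mult_iff)
    have "m < 2"
    proof (rule ccontr)
      assume "\<not> m < 2"
      hence "2 * (?a + \<beta> \<bullet> \<beta>) \<le> m * (?a + \<beta> \<bullet> \<beta>)" using pa pb by (intro mult_right_mono) auto
      hence "2 * (?a + \<beta> \<bullet> \<beta>) \<le> 2 * ?a" unfolding m' .
      thus False using pb by simp
    qed
    with mp have "m = 1" by simp
    with m' have "\<beta> \<bullet> \<beta> = 1 * ?a" by simp
    thus ?thesis using that[of 0 1] ab by simp
  next
    case False
    have "\<bar>c\<bar> * (\<beta> \<bullet> \<beta>) = \<bar>2 * (\<alpha> \<bullet> \<beta>)\<bar>" using c pb by (simp add: abs_mult)
    also have "\<dots> = \<bar>b\<bar> * ?a" using b pa by (simp add: abs_mult)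
    finally have cb: "\<bar>c\<bar> * (\<beta> \<bullet> \<beta>) = \<bar>b\<bar> * ?a" .
    have c0: "c \<noteq> 0" using cb False pa by auto
    have "\<bar>c\<bar> \<le> \<bar>b\<bar>"
    proof -
      have "\<bar>c\<bar> * ?a \<le> \<bar>c\<bar> * (\<beta> \<bullet> \<beta>)" using le by (intro mult_left_mono) auto
      hence "real_of_int \<bar>c\<bar> \<le> \<bar>b\<bar>" using cb pa by simp
      thus ?thesis by linarith
    qed
    moreover have "\<bar>c\<bar> * \<bar>b\<bar> \<le> 3" using bc by (simp add: abs_mult[symmetric] mult.commute)
    ultimately have c1: "\<bar>c\<bar> = 1"
      using mult_mono[of 2 "\<bar>c\<bar>" 2 "\<bar>b\<bar>"] c0 by (cases "\<bar>c\<bar> \<ge> 2") auto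
    hence bb: "\<beta> \<bullet> \<beta> = \<bar>b\<bar> * ?a" and b3: "\<bar>b\<bar> \<le> 3" using cb \<open>\<bar>c\<bar> * \<bar>b\<bar> \<le> 3\<close> by auto
    have "(2 + b) * ?a = (m * (1 + b + \<bar>b\<bar>)) * ?a" using m b bb by (simp add: algebra_simps)
    hence "real_of_int (2 + b) = real_of_int (m * (1 + b + \<bar>b\<bar>))" using pa by simp
    hence "2 + b = m * (1 + b + \<bar>b\<bar>)" by linarith
    moreover have "b \<in> {-3,-2,-1,1,2,3}" using b3 False by auto
    ultimately have "(\<bar>b\<bar>, b) \<in> {(1, 1), (1, 0), (1, -1), (2, -2), (3, -3)}"
      by auto presburger+
    thus ?thesis using that[of b "\<bar>b\<bar>"] b bb by simp
  qed
qed

text \<open>For \<open>k = 2\<close>, \<open>b = -2\<close> the divisor in \<open>d1\<close> is the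
  squared length of \<open>i \<alpha> + j \<beta>\<close> in units of that of \<alpha>, and the
  dividend is twice its inner product with \<alpha>. The form equals \<open>(i - j)^2 + j^2\<close>,
  which outgrows the linear dividend.\<close>

lemma B2_form_divisibility:
  fixes i j :: int
  assumes pos: "i > 0" "j > 0"
    and d1: "i * i - 2 * i * j + 2 * j * j dvd 2 * i - 2 * j" (is "?Q dvd _")
    and ne: "i \<noteq> j"
  shows "i = 2 \<and> j = 1"
proof -
  define d where "d = \<bar>i - j\<bar>"
  have Q: "?Q = d * d + j * j"
    unfolding d_def abs_mult_self_eq by (simp add: algebra_simps)
  have jj: "j * j \<ge> 1" using pos mult_mono[of 1 j 1 j] by simp
  have "\<bar>?Q\<bar> \<le> \<bar>2 * i - 2 * j\<bar>" using dvd_imp_le_int[OF _ d1] ne by simp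
  also have "\<dots> = 2 * d" unfolding d_def by arith
  finally have le: "d * d + j * j \<le> 2 * d" unfolding Q by simp
  have d1: "d = 1"
  proof (rule ccontr)
    assume "d \<noteq> 1"
    hence "d \<ge> 2" using ne by (simp add: d_def)
    hence "2 * d \<le> d * d" by (intro mult_right_mono) auto
    thus False using le jj by linarith
  qed
  hence "j * j \<le> 1" using le by simp
  hence "j \<le> 1" using mult_mono[of 2 j 2 j] pos by (cases "j \<ge> 2") auto
  thus ?thesis using d1 pos unfolding d_def by arith
qed

text \<open>The analogue for \<open>k = 3\<close>, \<open>b = -3\<close>: \<open>d1\<close> and
  \<open>d2\<close> come from the inner products with \<alpha> and \<beta>, and four times the form
  is \<open>(2i - 3j)^2 + 3j^2\<close>.\<close>

lemma G2_form_divisibility: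
  fixes i j :: int
  assumes pos: "i > 0" "j > 0"
    and d1: "i * i - 3 * i * j + 3 * j * j dvd 2 * i - 3 * j" (is "?Q dvd ?d")
    and d2: "i * i - 3 * i * j + 3 * j * j dvd 6 * j - 3 * i"
  shows "(i, j) \<in> {(1, 1), (2, 1), (3, 1), (3, 2)}"
proof (cases "?d = 0")
  \<comment> \<open>Here \<open>d1\<close> says nothing, its right side being 0; the candidates are
    the multiples of \<open>(3, 2)\<close>, and \<open>d2\<close> leaves only that pair
    itself.\<close>
  case True
  hence "even j" by presburger
  then obtain l where l: "j = 2 * l" ..
  hence i: "i = 3 * l" using True by simp
  have "3 * l * l dvd 3 * l" using d2 unfolding l i by (simp add: algebra_simps)
  hence "3 * l * l \<le> 3 * l" using pos l by (intro zdvd_imp_le) auto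
  hence "l * l \<le> 1 * l" by simp
  hence "l \<le> 1" using pos l by (simp only: mult_le_cancel_right)
  thus ?thesis using pos l i by auto
next
  case False
  define d where "d = \<bar>?d\<bar>"
  have Q: "4 * ?Q = d * d + 3 * (j * j)"
    unfolding d_def abs_mult_self_eq by (simp add: algebra_simps)
  have jj: "j * j \<ge> 1" using pos mult_mono[of 1 j 1 j] by simp
  have "\<bar>?Q\<bar> \<le> d" unfolding d_def by (rule dvd_imp_le_int[OF False d1])
  hence "4 * ?Q \<le> 4 * d" by simp
  hence le: "d * d + 3 * (j * j) \<le> 4 * d" unfolding Q .
  have d: "d \<le> 3"
  proof (rule ccontr)
    assume "\<not> ?thesis"
    hence "4 * d \<le> d * d" by (intro mult_right_mono) auto
    thus False using le jj by linarith
  qed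
  have "j \<le> 1"
  proof (rule ccontr)
    assume "\<not> ?thesis"
    hence "j * j \<ge> 2 * 2" by (intro mult_mono) auto
    moreover have "(d - 2) * (d - 2) \<ge> 0" by simp
    hence "d * d - 4 * d + 4 \<ge> 0" by (simp add: algebra_simps)
    ultimately show False using le by linarith
  qed
  with pos have "j = 1" by simp
  thus ?thesis using d pos unfolding d_def by auto
qed

text \<open>The two shapes are those that the two product lemmas below can treat. Roots of equal
  length give the first; a longer \<beta> gives the second, which is that of G2 and also covers
  B2.\<close>

lemma rank_two_positive_combinations:
  assumes rs: "root_system \<Phi>" "\<alpha> \<in> \<Phi>" "\<beta> \<in> \<Phi>" and sum: "\<alpha> + \<beta> \<in> \<Phi>" and le: "\<alpha> \<bullet> \<alpha> \<le> \<beta> \<bullet> \<beta>"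
  defines "P \<equiv> {(i, j). i > 0 \<and> j > 0 \<and> real i *\<^sub>R \<alpha> + real j *\<^sub>R \<beta> \<in> \<Phi>}"
  shows "P \<subseteq> {(1, 1), (2, 1), (1, 2)} \<or> P \<subseteq> {(1, 1), (2, 1), (3, 1), (3, 2)}"
proof -
  obtain k b :: int where b: "2 * (\<alpha> \<bullet> \<beta>) = b * (\<alpha> \<bullet> \<alpha>)" and k: "\<beta> \<bullet> \<beta> = k * (\<alpha> \<bullet> \<alpha>)"
    and kb: "(k, b) \<in> {(1, 1), (1, 0), (1, -1), (2, -2), (3, -3)}"
    using rank_two_forms[OF rs sum le] by metis
  have pa: "\<alpha> \<bullet> \<alpha> > 0" using root_inner_pos rs by auto
  \<comment> \<open>For a root with coefficients \<open>i\<close>, \<open>j\<close>: integrality of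
    the Cartan integers of \<alpha> and \<beta> relative to it, reducedness, and the bound 3 on its
    own Cartan integers relative to \<alpha> and \<beta>, the last scaled by
    \<open>k\<close>.\<close>
  have dvd: "i * i + i * j * b + k * j * j dvd 2 * i + j * b \<and>
     i * i + i * j * b + k * j * j dvd i * b + 2 * k * j \<and> (i = j \<longrightarrow> i = 1) \<and>
     \<bar>2 * i + j * b\<bar> \<le> 3 \<and> \<bar>i * b + 2 * k * j\<bar> \<le> 3 * k"
    if ij: "(nat i, nat j) \<in> P" for i j :: int
  proof -
    let ?g = "real_of_int i *\<^sub>R \<alpha> + real_of_int j *\<^sub>R \<beta>" and ?Q = "i * i + i * j * b + k * j * j"
    have pos: "i > 0" "j > 0" and g: "?g \<in> \<Phi>" using ij by (auto simp: P_def)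
    have ga: "2 * (?g \<bullet> \<alpha>) = (2 * i + j * b) * (\<alpha> \<bullet> \<alpha>)"
      using b by (simp add: inner_add inner_commute algebra_simps)
    have gb: "2 * (?g \<bullet> \<beta>) = (i * b + 2 * k * j) * (\<alpha> \<bullet> \<alpha>)"
      using b k by (simp add: inner_add inner_commute algebra_simps)
    have gg: "?g \<bullet> ?g = ?Q * (\<alpha> \<bullet> \<alpha>)"
    proof -
      have "2 * (?g \<bullet> ?g) = i * (2 * (?g \<bullet> \<alpha>)) + j * (2 * (?g \<bullet> \<beta>))"
        by (simp add: inner_add inner_commute algebra_simps)
      thus ?thesis unfolding ga gb by (simp add: algebra_simps)
    qed
    obtain m :: int where "2 * (?g \<bullet> \<alpha>) = m * (?g \<bullet> ?g)" using cartan_integer[OF rs(1) g rs(2)] by metis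
    hence "real_of_int (2 * i + j * b) = real_of_int (m * ?Q)" unfolding ga gg using pa by simp
    hence 1: "2 * i + j * b = m * ?Q" by linarith
    obtain n :: int where "2 * (?g \<bullet> \<beta>) = n * (?g \<bullet> ?g)" using cartan_integer[OF rs(1) g rs(3)] by metis
    hence "real_of_int (i * b + 2 * k * j) = real_of_int (n * ?Q)" unfolding gb gg using pa by simp
    hence 2: "i * b + 2 * k * j = n * ?Q" by linarith
    have 3: "i = j \<longrightarrow> i = 1"
    proof
      assume "i = j"
      hence "real_of_int i *\<^sub>R (\<alpha> + \<beta>) \<in> \<Phi>" using g by (simp add: scaleR_add_right)
      hence "real_of_int i = 1 \<or> real_of_int i = -1" using rs sum by (auto simp: root_system_def)
      thus "i = 1" using pos by linarith
    qed
    have nea: "?g \<noteq> c *\<^sub>R \<alpha>" for c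
    proof
      assume "?g = c *\<^sub>R \<alpha>"
      hence "real_of_int j *\<^sub>R \<beta> = (c - i) *\<^sub>R \<alpha>" by (simp add: algebra_simps)
      hence "(1 / real_of_int j) *\<^sub>R real_of_int j *\<^sub>R \<beta> = ((c - i) / j) *\<^sub>R \<alpha>"
        by (simp add: divide_inverse_commute)
      thus False using pos roots_not_proportional[OF rs sum] by simp
    qed
    have neb: "?g \<noteq> c *\<^sub>R \<beta>" for c
    proof
      assume "?g = c *\<^sub>R \<beta>"
      hence "real_of_int i *\<^sub>R \<alpha> = (c - j) *\<^sub>R \<beta>" by (simp add: algebra_simps)
      hence "(1 / real_of_int i) *\<^sub>R real_of_int i *\<^sub>R \<alpha> = ((c - j) / i) *\<^sub>R \<beta>"
        by (simp add: divide_inverse_commute)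
      thus False using pos roots_not_proportional[OF rs(1,3,2)] sum by (simp add: add.commute)
    qed
    have "2 * (\<alpha> \<bullet> ?g) = of_int (2 * i + j * b) * (\<alpha> \<bullet> \<alpha>)" using ga by (simp add: inner_commute)
    hence 4: "\<bar>2 * i + j * b\<bar> \<le> 3"
      using cartan_integer_abs_le[OF rs(1,2) g] nea[of 1] nea[of "-1"] by simp
    obtain n' :: int where n': "2 * (\<beta> \<bullet> ?g) = n' * (\<beta> \<bullet> \<beta>)" using cartan_integer[OF rs(1,3) g] by metis
    hence "of_int (i * b + 2 * k * j) * (\<alpha> \<bullet> \<alpha>) = of_int (n' * k) * (\<alpha> \<bullet> \<alpha>)"
      using gb k by (simp only: inner_commute of_int_mult mult.assoc)
    hence "real_of_int (i * b + 2 * k * j) = real_of_int (n' * k)" using pa by simp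
    hence n'': "i * b + 2 * k * j = n' * k" by linarith
    have "\<bar>n'\<bar> \<le> 3"
      using cartan_integer_abs_le[OF rs(1,3) g _ _ n'] neb[of 1] neb[of "-1"] by simp
    hence 5: "\<bar>i * b + 2 * k * j\<bar> \<le> 3 * k"
      unfolding n'' using kb by (auto simp: abs_mult)
    show ?thesis using 1 2 3 4 5 by simp
  qed
  have "(i, j) \<in> (if k = 1 then {(1, 1), (2, 1), (1, 2)} else {(1, 1), (2, 1), (3, 1), (3, 2)})"
    if ij: "(i, j) \<in> P" for i j
  proof -
    have pos: "i > 0" "j > 0" using ij by (auto simp: P_def)
    note D = dvd[of "int i" "int j", simplified, OF ij]
    consider "k = 1" "b = 1" | "k = 1" "b = 0" | "k = 1" "b = -1" | "k = 2" "b = -2" | "k = 3" "b = -3"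
      using kb by auto
    thus ?thesis
    proof cases
      case 1 thus ?thesis using D pos by auto
    next
      case 2 thus ?thesis using D pos by auto
    next
      case 3 
      \<comment> \<open>The bounds on the Cartan integers leave the three wanted pairs and diagonal
        ones, which reducedness restricts to \<open>(1, 1)\<close>.\<close>
      have "i = j \<longrightarrow> j = 1" "2 * i \<le> j + 3" "2 * j \<le> i + 3" using D 3 by auto
      hence "i = 1 \<and> j = 1 \<or> i = 2 \<and> j = 1 \<or> i = 1 \<and> j = 2" using pos by arith
      thus ?thesis using 3 by auto
    next
      case 4
      have "int i * int i - 2 * int i * int j + 2 * int j * int j dvd 2 * int i - 2 * int j" "i = j \<longrightarrow> j = 1"
        using D 4 by (simp_all add: algebra_simps)
      from B2_form_divisibility[OF _ _ this(1)] this(2) show ?thesis using pos 4 by auto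
    next
      case 5
      have "int i * int i - 3 * int i * int j + 3 * int j * int j dvd 2 * int i - 3 * int j"
        "int i * int i - 3 * int i * int j + 3 * int j * int j dvd 6 * int j - 3 * int i"
        using D 5 by (simp_all add: algebra_simps)
      from G2_form_divisibility[OF _ _ this] show ?thesis using pos 5 by auto
    qed
  qed
  thus ?thesis by (cases "k = 1") (auto split: if_splits)
qed

text \<open>The Cartan integers of \<beta> and of \<open>\<beta> - q \<alpha>\<close> relative to
  \<alpha> differ by \<open>2 * q\<close> and both lie between -3 and 3, so
  \<open>q \<le> 3\<close>. The bound 4 keeps the constants nonzero modulo every prime above
  3.\<close>

lemma chevalley_constant_bounds:
  assumes rs: "root_system \<Phi>" and N: "chevalley_constants \<Phi> N"
    and ab: "\<alpha> \<in> \<Phi>" "\<beta> \<in> \<Phi>" "\<alpha> + \<beta> \<in> \<Phi>"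
  shows "0 < \<bar>N \<alpha> \<beta>\<bar>" "\<bar>N \<alpha> \<beta>\<bar> \<le> 4"
proof -
  let ?R = "\<lambda>q::nat. \<beta> - real q *\<^sub>R \<alpha> \<in> \<Phi>"
  have bound: "q \<le> 3" if q: "?R q" for q
  proof -
    obtain b :: int where b: "2 * (\<alpha> \<bullet> \<beta>) = b * (\<alpha> \<bullet> \<alpha>)" using cartan_integer rs ab by metis
    have ne': "\<beta> \<noteq> - \<alpha>" using rs ab by (auto simp: root_system_def)
    note ne = roots_not_proportional[OF rs ab]
    have "\<beta> \<noteq> \<alpha>" using ne[of 1] by simp
    from cartan_integer_abs_le[OF rs ab(1,2) this ne' b] have b3: "\<bar>b\<bar> \<le> 3" .
    have "2 * (\<alpha> \<bullet> (\<beta> - real q *\<^sub>R \<alpha>)) = of_int (b - 2 * int q) * (\<alpha> \<bullet> \<alpha>)"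
      using b by (simp add: inner_diff algebra_simps)
    moreover have "\<beta> - real q *\<^sub>R \<alpha> \<noteq> \<alpha>" "\<beta> - real q *\<^sub>R \<alpha> \<noteq> - \<alpha>"
      using ne[of "1 + real q"] ne[of "real q - 1"] by (auto simp: algebra_simps)
    ultimately have "\<bar>b - 2 * int q\<bar> \<le> 3" using cartan_integer_abs_le[OF rs ab(1) q] by blast
    thus ?thesis using b3 by linarith
  qed
  have "?R (GREATEST q. ?R q)" using GreatestI_nat[of ?R 0 3] ab bound by simp
  hence "(GREATEST q. ?R q) \<le> 3" by (rule bound)
  moreover have "\<bar>N \<alpha> \<beta>\<bar> = int (GREATEST p. ?R p) + 1"
    using N ab by (simp add: chevalley_constants_def)
  ultimately show "0 < \<bar>N \<alpha> \<beta>\<bar>" "\<bar>N \<alpha> \<beta>\<bar> \<le> 4" by auto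
qed

section \<open>Presented groups\<close>

abbreviation word_class :: "'g set \<Rightarrow> ('g gword \<times> 'g gword) set \<Rightarrow> 'g gword \<Rightarrow> 'g gword set" where
  "word_class X R w \<equiv> word_eq X R `` {w}"

lemma gwords_simps [simp]:
  "[] \<in> gwords X" "p # w \<in> gwords X \<longleftrightarrow> fst p \<in> X \<and> w \<in> gwords X"
  "v @ w \<in> gwords X \<longleftrightarrow> v \<in> gwords X \<and> w \<in> gwords X"
  by (auto simp: gwords_def mem_Times_iff)

lemma winv_simps [simp]: "winv [] = []" "winv (p # w) = winv w @ [(fst p, \<not> snd p)]"
  by (auto simp: winv_def split: prod.splits)

lemma winv_in_gwords [simp]: "w \<in> gwords X \<Longrightarrow> winv w \<in> gwords X"
  by (induction w) auto

lemma word_eq_in_gwords: "(v, w) \<in> word_eq X R \<Longrightarrow> v \<in> gwords X \<and> w \<in> gwords X"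
  by (induction rule: word_eq.induct) auto

lemma word_eq_context:
  "(v, w) \<in> word_eq X R \<Longrightarrow> a \<in> gwords X \<Longrightarrow> b \<in> gwords X \<Longrightarrow> (a @ v @ b, a @ w @ b) \<in> word_eq X R"
proof (induction rule: word_eq.induct)
  case (cancel v w g c)
  thus ?case using word_eq.cancel[of "a @ v" X "w @ b" g c R] by simp
next
  case (relation v w l r)
  thus ?case using word_eq.relation[of "a @ v" X "w @ b" l r R] by simp
qed (auto intro: word_eq.refl word_eq.sym word_eq.trans)

lemma word_eq_append:
  assumes "(v, v') \<in> word_eq X R" "(w, w') \<in> word_eq X R"
  shows "(v @ w, v' @ w') \<in> word_eq X R"
  using word_eq_context[OF assms(1), of "[]" w] word_eq_context[OF assms(2), of v' "[]"]
    word_eq_in_gwords[OF assms(1)] word_eq_in_gwords[OF assms(2)] by (auto intro: word_eq.trans)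

lemma equiv_word_eq: "equiv (gwords X) (word_eq X R)"
  by (rule equivI) (auto intro!: refl_onI symI transI intro: word_eq.intros dest: word_eq_in_gwords)

lemma word_class_eq_iff:
  "v \<in> gwords X \<Longrightarrow> w \<in> gwords X \<Longrightarrow> word_class X R v = word_class X R w \<longleftrightarrow> (v, w) \<in> word_eq X R"
  using eq_equiv_class_iff[OF equiv_word_eq] by blast

lemma word_class_relation:
  assumes "(l, r) \<in> R" "l \<in> gwords X" "r \<in> gwords X"
  shows "word_class X R l = word_class X R r"
  using word_eq.relation[of "[]" X "[]" l r R] assms by (simp add: word_class_eq_iff)

lemma word_eq_winv: "w \<in> gwords X \<Longrightarrow> (winv w @ w, []) \<in> word_eq X R"
proof (induction w)
  case (Cons p w)
  have "(winv w @ [(fst p, \<not> snd p), (fst p, \<not> \<not> snd p)] @ w, winv w @ w) \<in> word_eq X R"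
    using Cons.prems by (intro word_eq.cancel) auto
  thus ?case using Cons by (auto intro: word_eq.trans)
qed (auto intro: word_eq.refl)

lemma word_class_in_carrier [simp]:
  "w \<in> gwords X \<Longrightarrow> word_class X R w \<in> carrier (presented_group X R)"
  by (simp add: presented_group_def quotientI)

lemma presented_group_carrierE:
  assumes "A \<in> carrier (presented_group X R)"
  obtains w where "w \<in> gwords X" "A = word_class X R w"
  using assms by (auto simp: presented_group_def elim: quotientE)

lemma presented_group_one: "\<one>\<^bsub>presented_group X R\<^esub> = word_class X R []"
  by (simp add: presented_group_def)

lemma presented_group_mult:
  assumes "v \<in> gwords X" "w \<in> gwords X"
  shows "word_class X R v \<otimes>\<^bsub>presented_group X R\<^esub> word_class X R w = word_class X R (v @ w)"
proof -
  \<comment> \<open>All products of representatives are equivalent, so the union in the definition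
    of the multiplication collapses to one class.\<close>
  have "word_class X R (v' @ w') = word_class X R (v @ w)"
    if "v' \<in> word_class X R v" "w' \<in> word_class X R w" for v' w'
    using that assms word_eq_append[of v v' X R w w'] word_eq_in_gwords[of v v'] word_eq_in_gwords[of w w']
    by (auto simp: word_class_eq_iff intro: word_eq.sym)
  moreover have "v \<in> word_class X R v" "w \<in> word_class X R w" using assms by (auto intro: word_eq.refl)
  ultimately have "(\<Union>v'\<in>word_class X R v. \<Union>w'\<in>word_class X R w. word_class X R (v' @ w')) = word_class X R (v @ w)"
    by blast
  thus ?thesis by (simp add: presented_group_def)
qed

lemma group_presented_group: "group (presented_group X R)"
proof (rule groupI)
  fix A B C
  assume "A \<in> carrier (presented_group X R)" "B \<in> carrier (presented_group X R)" "C \<in> carrier (presented_group X R)"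
  thus "A \<otimes>\<^bsub>presented_group X R\<^esub> B \<otimes>\<^bsub>presented_group X R\<^esub> C =
      A \<otimes>\<^bsub>presented_group X R\<^esub> (B \<otimes>\<^bsub>presented_group X R\<^esub> C)"
    by (elim presented_group_carrierE) (simp add: presented_group_mult)
next
  fix A assume "A \<in> carrier (presented_group X R)"
  then obtain w where w: "w \<in> gwords X" "A = word_class X R w" by (rule presented_group_carrierE)
  hence "word_class X R (winv w) \<otimes>\<^bsub>presented_group X R\<^esub> A = \<one>\<^bsub>presented_group X R\<^esub>"
    by (simp add: presented_group_mult presented_group_one word_class_eq_iff word_eq_winv)
  thus "\<exists>B\<in>carrier (presented_group X R). B \<otimes>\<^bsub>presented_group X R\<^esub> A = \<one>\<^bsub>presented_group X R\<^esub>"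
    using w by (meson winv_in_gwords word_class_in_carrier)
qed (auto elim!: presented_group_carrierE simp: presented_group_mult presented_group_one)

lemma presented_group_inv:
  assumes "w \<in> gwords X"
  shows "inv\<^bsub>presented_group X R\<^esub> word_class X R w = word_class X R (winv w)"
proof -
  interpret group "presented_group X R" by (rule group_presented_group)
  show ?thesis using assms
    by (intro inv_equality)
      (simp_all add: presented_group_mult presented_group_one word_class_eq_iff word_eq_winv)
qed

lemma presented_group_subset_subgroup:
  assumes H: "subgroup H (presented_group X R)"
    and gen: "\<And>g. g \<in> X \<Longrightarrow> word_class X R [(g, True)] \<in> H"
  shows "carrier (presented_group X R) \<subseteq> H"
proof -
  interpret H: subgroup H "presented_group X R" by (rule H)
  have "word_class X R w \<in> H" if "w \<in> gwords X" for w
    using that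
  proof (induction w)
    case Nil
    thus ?case using H.one_closed by (simp add: presented_group_one)
  next
    case (Cons p w)
    hence p: "fst p \<in> X" "w \<in> gwords X" by auto
    have "word_class X R [p] \<in> H"
    proof (cases "snd p")
      case True
      thus ?thesis using gen[OF p(1)] by (metis prod.collapse)
    next
      case False
      thus ?thesis using H.m_inv_closed[OF gen[OF p(1)]] p
        by (simp add: presented_group_inv) (metis prod.collapse)
    qed
    from H.m_closed[OF this Cons.IH[OF p(2)]] show ?case using p
      by (simp add: presented_group_mult)
  qed
  thus ?thesis by (auto elim: presented_group_carrierE)
qed

section \<open>Products of root elements in a subgroup\<close>

context group
begin

lemma commute_assoc:
  assumes "a \<in> carrier G" "b \<in> carrier G" "c \<in> carrier G" "a \<otimes> b = b \<otimes> a"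
  shows "a \<otimes> (b \<otimes> c) = b \<otimes> (a \<otimes> c)"
  using assms by (simp add: m_assoc[symmetric])

lemma commute_inv:
  assumes "a \<in> carrier G" "b \<in> carrier G" "a \<otimes> b = b \<otimes> a"
  shows "a \<otimes> inv b = inv b \<otimes> a"
proof -
  have "(b \<otimes> a) \<otimes> inv b = a" by (subst assms(3)[symmetric]) (simp add: m_assoc assms(1,2))
  thus ?thesis using assms(1,2) by (simp add: m_assoc inv_solve_left)
qed

lemma commutator_eq_imp:
  assumes "a \<in> carrier G" "b \<in> carrier G" "c \<in> carrier G" "a \<otimes> b \<otimes> inv a \<otimes> inv b = c"
  shows "a \<otimes> b = c \<otimes> (b \<otimes> a)"
proof -
  have "a \<otimes> b \<otimes> inv (b \<otimes> a) = c" using assms by (simp add: inv_mult_group m_assoc)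
  thus ?thesis using assms(1-3) by (simp only: inv_solve_right' m_closed)
qed

text \<open>Meant for the index pairs \<open>(1, 1)\<close>, \<open>(2, 1)\<close>,
  \<open>(1, 2)\<close>: changing the signs of both parameters keeps the factor \<open>a\<close> of
  even total degree and inverts \<open>b\<close> and \<open>c\<close>, which then cancel in the
  product.\<close>

lemma mult_inverse_twist_commuting:
  assumes c: "a \<in> carrier G" "b \<in> carrier G" "c \<in> carrier G"
    and "a \<otimes> b = b \<otimes> a" "a \<otimes> c = c \<otimes> a" "b \<otimes> c = c \<otimes> b"
  shows "a \<otimes> (b \<otimes> c) \<otimes> (a \<otimes> (inv b \<otimes> inv c)) = a \<otimes> a"
proof -
  let ?w = "b \<otimes> c"
  have w: "inv b \<otimes> inv c = inv ?w" using assms by (simp add: inv_mult_group)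
  have "?w \<otimes> a = b \<otimes> (a \<otimes> c)" using c by (simp add: m_assoc assms(5))
  also have "\<dots> = a \<otimes> ?w" using assms by (intro commute_assoc) auto
  finally have "?w \<otimes> a = a \<otimes> ?w" .
  hence "?w \<otimes> (a \<otimes> inv ?w) = a \<otimes> (?w \<otimes> inv ?w)" using c by (intro commute_assoc) auto
  thus ?thesis using c by (simp add: w m_assoc[of a])
qed

text \<open>Meant for \<open>a\<close>, \<open>b\<close>, \<open>d\<close>, \<open>e\<close> at the
  index pairs \<open>(1, 1)\<close>, \<open>(2, 1)\<close>, \<open>(3, 1)\<close>,
  \<open>(3, 2)\<close>: a change of both signs inverts the odd factors \<open>b\<close> and
  \<open>e\<close>. Moving \<open>b\<close> past \<open>a\<close> costs the commutator
  \<open>k\<close>, which remains along with two copies each of \<open>a\<close> and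
  \<open>d\<close>.\<close>

lemma mult_inverse_twist_central:
  assumes c: "a \<in> carrier G" "b \<in> carrier G" "d \<in> carrier G" "e \<in> carrier G" "k \<in> carrier G"
    and ba: "b \<otimes> a = k \<otimes> (a \<otimes> b)"
    and da: "d \<otimes> a = a \<otimes> d" and db: "d \<otimes> b = b \<otimes> d"
    and ea: "e \<otimes> a = a \<otimes> e" and eb: "e \<otimes> b = b \<otimes> e" and ed: "e \<otimes> d = d \<otimes> e"
    and ka: "k \<otimes> a = a \<otimes> k" and kd: "k \<otimes> d = d \<otimes> k"
  shows "a \<otimes> (b \<otimes> (d \<otimes> e)) \<otimes> (a \<otimes> (inv b \<otimes> (d \<otimes> inv e))) = (a \<otimes> a) \<otimes> ((d \<otimes> d) \<otimes> k)"
proof -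
  have z: "d \<otimes> (e \<otimes> (a \<otimes> (inv b \<otimes> (d \<otimes> inv e)))) = a \<otimes> (inv b \<otimes> (d \<otimes> d))"
    using c commute_inv[OF c(3,2) db] commute_inv[OF c(4,2) eb]
    by (simp add: commute_assoc[of e] commute_assoc[of d a] commute_assoc[of d "inv b"] ea ed da)
  have ba': "b \<otimes> (a \<otimes> f) = k \<otimes> (a \<otimes> (b \<otimes> f))" if "f \<in> carrier G" for f
    using c that ba by (simp add: m_assoc[symmetric])
  have "b \<otimes> (a \<otimes> (inv b \<otimes> (d \<otimes> d))) = k \<otimes> (a \<otimes> (d \<otimes> d))"
    using c by (simp add: ba' m_assoc[symmetric, of b "inv b"])
  also have "\<dots> = a \<otimes> (d \<otimes> d \<otimes> k)"
    using c by (simp add: commute_assoc[of k] ka kd m_assoc)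
  finally show ?thesis using c z by (simp add: m_assoc)
qed

end

text \<open>The parameters range over a commutative ring of characteristic \<open>p\<close> instead of the field, so that
  the residue class field is covered through the quotient map from polynomials.\<close>

locale steinberg_system = group G for G :: "('g, 'm) monoid_scheme" (structure) +
  fixes \<Phi> :: "'v::euclidean_space set" and N :: "'v \<Rightarrow> 'v \<Rightarrow> int"
    and x :: "'v \<Rightarrow> 'a::comm_ring_1 \<Rightarrow> 'g" and p :: nat
  assumes roots: "root_system \<Phi>" and constants: "chevalley_constants \<Phi> N"
    and p: "prime p" "p > 3" "of_nat p = (0 :: 'a)"
    and x_closed: "\<alpha> \<in> \<Phi> \<Longrightarrow> x \<alpha> t \<in> carrier G"
    and x_add: "\<alpha> \<in> \<Phi> \<Longrightarrow> x \<alpha> t \<otimes> x \<alpha> u = x \<alpha> (t + u)"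
    and x_comm: "\<alpha> \<in> \<Phi> \<Longrightarrow> \<beta> \<in> \<Phi> \<Longrightarrow> \<alpha> + \<beta> \<noteq> 0 \<Longrightarrow>
      distinct ijs \<Longrightarrow> sorted (map (\<lambda>(i, j). i + j) ijs) \<Longrightarrow>
      set ijs = {(i, j). i > 0 \<and> j > 0 \<and> real i *\<^sub>R \<alpha> + real j *\<^sub>R \<beta> \<in> \<Phi>} \<Longrightarrow>
      x \<alpha> t \<otimes> x \<beta> u \<otimes> inv (x \<alpha> t) \<otimes> inv (x \<beta> u) =
      foldr (\<lambda>(i, j) g. x (real i *\<^sub>R \<alpha> + real j *\<^sub>R \<beta>) (of_int (comm_const N \<alpha> \<beta> i j) * (t ^ i * u ^ j)) \<otimes> g)
        ijs \<one>"
begin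

section \<open>Root elements and the padded commutator formula\<close>

lemma x_zero: "\<alpha> \<in> \<Phi> \<Longrightarrow> x \<alpha> 0 = \<one>"
  using x_add[of \<alpha> 0 0] x_closed[of \<alpha> 0] by (metis add_0 l_cancel_one)

lemma x_minus: "\<alpha> \<in> \<Phi> \<Longrightarrow> x \<alpha> (- t) = inv (x \<alpha> t)"
  using x_add[of \<alpha> "- t" t] x_closed x_zero by (metis add.left_inverse inv_equality)

text \<open>\<open>xij \<alpha> \<beta> i j\<close> is the root element of \<open>i\<alpha> + j\<beta>\<close>, or trivial if this is not a root, so that
  the commutator formula has the same shape in all root systems of rank two.\<close>

definition xij :: "'v \<Rightarrow> 'v \<Rightarrow> nat \<Rightarrow> nat \<Rightarrow> 'a \<Rightarrow> 'g" where
  "xij \<alpha> \<beta> i j t = (if real i *\<^sub>R \<alpha> + real j *\<^sub>R \<beta> \<in> \<Phi> then x (real i *\<^sub>R \<alpha> + real j *\<^sub>R \<beta>) t else \<one>)"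

lemma xij_closed [simp]: "xij \<alpha> \<beta> i j t \<in> carrier G"
  by (simp add: xij_def x_closed)

lemma xij_add: "xij \<alpha> \<beta> i j t \<otimes> xij \<alpha> \<beta> i j u = xij \<alpha> \<beta> i j (t + u)"
  by (simp add: xij_def x_add)

lemma xij_minus: "xij \<alpha> \<beta> i j (- t) = inv (xij \<alpha> \<beta> i j t)"
  by (simp add: xij_def x_minus)

lemma xij_zero: "xij \<alpha> \<beta> i j 0 = \<one>"
  by (simp add: xij_def x_zero)

text \<open>Pairs in \<open>L\<close> that give no root contribute trivial factors, so one fixed
  list serves several rank two configurations.\<close>

lemma commutator_xij:
  assumes ab: "\<alpha> \<in> \<Phi>" "\<beta> \<in> \<Phi>" "\<alpha> + \<beta> \<noteq> 0"
    and L: "distinct L" "sorted (map (\<lambda>(i, j). i + j) L)" "set L \<subseteq> {(i, j). i > 0 \<and> j > 0}"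
    and P: "{(i, j). i > 0 \<and> j > 0 \<and> real i *\<^sub>R \<alpha> + real j *\<^sub>R \<beta> \<in> \<Phi>} \<subseteq> set L"
  shows "x \<alpha> t \<otimes> x \<beta> u \<otimes> inv (x \<alpha> t) \<otimes> inv (x \<beta> u) =
    foldr (\<lambda>(i, j) g. xij \<alpha> \<beta> i j (of_int (comm_const N \<alpha> \<beta> i j) * (t ^ i * u ^ j)) \<otimes> g) L \<one>"
proof -
  let ?Q = "\<lambda>(i, j). real i *\<^sub>R \<alpha> + real j *\<^sub>R \<beta> \<in> \<Phi>"
  let ?F = "\<lambda>(i, j) g. x (real i *\<^sub>R \<alpha> + real j *\<^sub>R \<beta>) (of_int (comm_const N \<alpha> \<beta> i j) * (t ^ i * u ^ j)) \<otimes> g"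
  let ?F' = "\<lambda>(i, j) g. xij \<alpha> \<beta> i j (of_int (comm_const N \<alpha> \<beta> i j) * (t ^ i * u ^ j)) \<otimes> g"
  have "x \<alpha> t \<otimes> x \<beta> u \<otimes> inv (x \<alpha> t) \<otimes> inv (x \<beta> u) = foldr ?F (filter ?Q L) \<one>"
    using L P by (intro x_comm ab) (auto intro: sorted_filter)
  also have "\<dots> = foldr ?F' L \<one>"
  proof -
    have "foldr ?F (filter ?Q M) \<one> = foldr ?F' M \<one> \<and> foldr ?F' M \<one> \<in> carrier G" for M
      by (induction M) (auto simp: xij_def x_closed)
    thus ?thesis ..
  qed
  finally show ?thesis .
qed

lemma combination_nonzero:
  assumes "\<alpha> \<in> \<Phi>" "\<beta> \<in> \<Phi>" "\<alpha> + \<beta> \<in> \<Phi>" "j > 0"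
  shows "real i *\<^sub>R \<alpha> + real j *\<^sub>R \<beta> \<noteq> 0"
proof
  assume "real i *\<^sub>R \<alpha> + real j *\<^sub>R \<beta> = 0"
  hence "real j *\<^sub>R \<beta> = (- real i) *\<^sub>R \<alpha>" by (simp add: add_eq_0_iff)
  hence "(1 / real j) *\<^sub>R real j *\<^sub>R \<beta> = (- real i / real j) *\<^sub>R \<alpha>" by (simp add: divide_inverse_commute)
  hence "\<beta> = (- real i / real j) *\<^sub>R \<alpha>" using assms(4) by simp
  thus False using roots_not_proportional[OF roots assms(1-3)] by metis
qed

text \<open>The commutator formula for the two roots is an empty product: by \<open>no\<close>, none
  of their positive combinations is a root.\<close>

lemma xij_comm:
  assumes ab: "\<alpha> \<in> \<Phi>" "\<beta> \<in> \<Phi>" "\<alpha> + \<beta> \<in> \<Phi>" and pos: "j > 0"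
    and P: "{(m, n). m > 0 \<and> n > 0 \<and> real m *\<^sub>R \<alpha> + real n *\<^sub>R \<beta> \<in> \<Phi>} \<subseteq> P"
    and no: "\<And>m n. m > 0 \<Longrightarrow> n > 0 \<Longrightarrow> (m * i + n * k, m * j + n * l) \<notin> P"
    and i: "i > 0"
  shows "xij \<alpha> \<beta> i j t \<otimes> xij \<alpha> \<beta> k l u = xij \<alpha> \<beta> k l u \<otimes> xij \<alpha> \<beta> i j t"
proof (cases "real i *\<^sub>R \<alpha> + real j *\<^sub>R \<beta> \<in> \<Phi> \<and> real k *\<^sub>R \<alpha> + real l *\<^sub>R \<beta> \<in> \<Phi>")
  case True
  let ?g = "real i *\<^sub>R \<alpha> + real j *\<^sub>R \<beta>" and ?d = "real k *\<^sub>R \<alpha> + real l *\<^sub>R \<beta>"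
  have comb: "real m *\<^sub>R ?g + real n *\<^sub>R ?d = real (m * i + n * k) *\<^sub>R \<alpha> + real (m * j + n * l) *\<^sub>R \<beta>" for m n
    by (simp add: algebra_simps)
  have "?g + ?d \<noteq> 0"
    using combination_nonzero[OF ab, of "j + l" "i + k"] pos comb[of 1 1] by simp
  moreover have "real m *\<^sub>R ?g + real n *\<^sub>R ?d \<notin> \<Phi>" if "m > 0" "n > 0" for m n
  proof -
    have "m * i + n * k > 0" "m * j + n * l > 0" using that i pos by simp_all
    thus ?thesis using no[OF that] P unfolding comb by blast
  qed
  ultimately have "x ?g t \<otimes> x ?d u \<otimes> inv (x ?g t) \<otimes> inv (x ?d u) = \<one>"
    using x_comm[of ?g ?d "[]" t u] True by auto
  hence "x ?g t \<otimes> x ?d u = x ?d u \<otimes> x ?g t"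
    using commutator_eq_imp[of "x ?g t" "x ?d u" \<one>] True x_closed by simp
  thus ?thesis using True by (simp add: xij_def)
next
  case False
  thus ?thesis by (auto simp: xij_def x_closed)
qed

section \<open>Root elements lying in a fixed subgroup\<close>

context
  fixes H assumes H: "subgroup H G"
begin

interpretation H: subgroup H G by (rule H)

lemma x_add_mem: "\<alpha> \<in> \<Phi> \<Longrightarrow> x \<alpha> t \<in> H \<Longrightarrow> x \<alpha> u \<in> H \<Longrightarrow> x \<alpha> (t + u) \<in> H"
  using H.m_closed x_add by metis

lemma x_minus_mem: "\<alpha> \<in> \<Phi> \<Longrightarrow> x \<alpha> t \<in> H \<Longrightarrow> x \<alpha> (- t) \<in> H"
  using x_minus by simp

lemma x_of_int_mem:
  assumes "\<alpha> \<in> \<Phi>" "x \<alpha> t \<in> H" shows "x \<alpha> (of_int k * t) \<in> H"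
proof -
  have "x \<alpha> (of_nat n * t) \<in> H" for n
  proof (induction n)
    case 0 thus ?case using assms H.one_closed by (simp add: x_zero)
  next
    case (Suc n) thus ?case using x_add_mem[OF assms(1,2) Suc] by (simp add: distrib_right)
  qed
  thus ?thesis using x_minus_mem[OF assms(1)]
    by (cases k rule: int_cases2) (auto simp del: of_nat_Suc)
qed

text \<open>The parameter ring has characteristic \<open>p\<close>, so a Bezout coefficient
  \<open>m\<close> of \<open>k\<close> inverts \<open>k\<close> in it, and multiplying the parameter
  by the integer \<open>m\<close> stays inside \<open>H\<close>.\<close>

lemma x_cancel_int_mem:
  assumes "\<alpha> \<in> \<Phi>" "x \<alpha> (of_int k * t) \<in> H" and k: "\<not> int p dvd k"
  shows "x \<alpha> t \<in> H"
proof -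
  have "coprime (int p) k" using k p by (intro prime_imp_coprime) auto
  then obtain l m where "l * int p + m * k = 1"
    using bezout_int[of "int p" k] by (metis coprime_imp_gcd_eq_1)
  hence "(of_int (l * int p + m * k) :: 'a) = of_int 1" by simp
  hence "of_int m * of_int k = (1 :: 'a)" using p by simp
  hence "of_int m * (of_int k * t) = t" by (simp add: mult.assoc[symmetric])
  thus ?thesis using x_of_int_mem[OF assms(1,2), of m] by simp
qed

lemma commutator_mem:
  "\<alpha> \<in> \<Phi> \<Longrightarrow> \<beta> \<in> \<Phi> \<Longrightarrow> x \<alpha> t \<in> H \<Longrightarrow> x \<beta> u \<in> H \<Longrightarrow> x \<alpha> t \<otimes> x \<beta> u \<otimes> inv (x \<alpha> t) \<otimes> inv (x \<beta> u) \<in> H"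
  by simp

text \<open>The factors 2 and 12 are those left over by the two product lemmas below. Their prime
  divisors are 2 and 3, and the structure constant is between 1 and 4 in absolute value.\<close>

lemma not_dvd_constant:
  assumes "\<alpha> \<in> \<Phi>" "\<beta> \<in> \<Phi>" "\<alpha> + \<beta> \<in> \<Phi>" and "m \<in> {2, 12}"
  shows "\<not> int p dvd m * comm_const N \<alpha> \<beta> 1 1"
proof
  have c: "comm_const N \<alpha> \<beta> 1 1 = N \<alpha> \<beta>" by (simp add: comm_const_def string_const_def)
  have prime: "prime (int p)" using p by simp
  assume "int p dvd m * comm_const N \<alpha> \<beta> 1 1"
  hence "int p dvd m \<or> int p dvd N \<alpha> \<beta>" using prime c by (simp add: prime_dvd_mult_iff)
  thus False
  proof
    assume "int p dvd m"
    hence "int p dvd 2 * 2 * 3" using assms(4) by (auto elim: dvd_trans)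
    hence "int p dvd 2 \<or> int p dvd 3" using prime by (simp only: prime_dvd_mult_iff) auto
    thus False using p zdvd_imp_le[of "int p" 2] zdvd_imp_le[of "int p" 3] by auto
  next
    note b = chevalley_constant_bounds[OF roots constants assms(1-3)]
    assume "int p dvd N \<alpha> \<beta>"
    hence "int p \<le> \<bar>N \<alpha> \<beta>\<bar>" using b by (intro zdvd_imp_le) auto
    hence "p = 4" using b p by linarith
    moreover have "\<not> prime (2 * 2 :: nat)" by (simp add: prime_product)
    ultimately show False using p by simp
  qed
qed

text \<open>The commutators for \<open>(t, u)\<close> and \<open>(- t, - u)\<close> multiply to the
  element of \<alpha> + \<beta> whose parameter is \<open>t * u\<close> times twice the structure
  constant, an integer invertible modulo \<open>p\<close>.\<close>

lemma x_mult_mem_short: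
  assumes ab: "\<alpha> \<in> \<Phi>" "\<beta> \<in> \<Phi>" "\<alpha> + \<beta> \<in> \<Phi>"
    and P: "{(i, j). i > 0 \<and> j > 0 \<and> real i *\<^sub>R \<alpha> + real j *\<^sub>R \<beta> \<in> \<Phi>} \<subseteq> {(1, 1), (2, 1), (1, 2)}"
    and H: "x \<alpha> t \<in> H" "x \<beta> u \<in> H"
  shows "x (\<alpha> + \<beta>) (t * u) \<in> H"
proof -
  let ?y = "xij \<alpha> \<beta>" and ?C = "\<lambda>i j. of_int (comm_const N \<alpha> \<beta> i j) :: 'a"
  let ?a = "?y 1 1 (?C 1 1 * (t * u))" and ?b = "?y 2 1 (?C 2 1 * (t\<^sup>2 * u))" and ?c = "?y 1 2 (?C 1 2 * (t * u\<^sup>2))"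
  have nz: "\<alpha> + \<beta> \<noteq> 0" using ab roots by (auto simp: root_system_def)
  have g: "?y 1 1 (?C 1 1 * (t * u)) \<otimes> (?y 2 1 (?C 2 1 * (t\<^sup>2 * u)) \<otimes> ?y 1 2 (?C 1 2 * (t * u\<^sup>2))) \<in> H"
    if "x \<alpha> t \<in> H" "x \<beta> u \<in> H" for t u
    using commutator_mem[OF ab(1,2) that] P
      commutator_xij[OF ab(1,2) nz, of "[(1, 1), (2, 1), (1, 2)]" t u] by simp
  have "?a \<otimes> (?b \<otimes> ?c) \<otimes> (?a \<otimes> (inv ?b \<otimes> inv ?c)) \<in> H"
    using H.m_closed[OF g[OF H] g[OF x_minus_mem[OF _ H(1)] x_minus_mem[OF _ H(2)]]] ab
    by (simp add: xij_minus[symmetric])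
  \<comment> \<open>Positive combinations of two different index pairs have both entries at least 2,
    so \<open>xij_comm\<close> applies.\<close>
  moreover have "?a \<otimes> (?b \<otimes> ?c) \<otimes> (?a \<otimes> (inv ?b \<otimes> inv ?c)) = ?a \<otimes> ?a"
    by (intro mult_inverse_twist_commuting xij_comm[OF ab _ P] xij_closed) auto
  ultimately have "?a \<otimes> ?a \<in> H" by simp
  hence "x (\<alpha> + \<beta>) (of_int (2 * comm_const N \<alpha> \<beta> 1 1) * (t * u)) \<in> H"
    using ab by (simp add: xij_add) (simp add: xij_def algebra_simps)
  from x_cancel_int_mem[OF ab(3) this not_dvd_constant[OF ab]] show ?thesis by simp
qed

text \<open>In type \<open>G\<^sub>2\<close> the product of the commutators for \<open>(t, u)\<close> and \<open>(-t, -u)\<close> only involves the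
  pairwise commuting root subgroups of \<open>\<alpha> + \<beta>\<close>, \<open>3\<alpha> + \<beta>\<close> and \<open>3\<alpha> + 2\<beta>\<close>, with parameters that are
  homogeneous in \<open>t\<close> of degree \<open>1\<close>, \<open>3\<close> and \<open>3\<close>. The eighth power of its value at \<open>t\<close> times its value at
  \<open>-2t\<close> hence lies in the root subgroup of \<open>\<alpha> + \<beta>\<close>.\<close>

lemma x_mult_mem_long:
  assumes ab: "\<alpha> \<in> \<Phi>" "\<beta> \<in> \<Phi>" "\<alpha> + \<beta> \<in> \<Phi>"
    and P: "{(i, j). i > 0 \<and> j > 0 \<and> real i *\<^sub>R \<alpha> + real j *\<^sub>R \<beta> \<in> \<Phi>} \<subseteq> {(1, 1), (2, 1), (3, 1), (3, 2)}"
    and H: "x \<alpha> t \<in> H" "x \<beta> u \<in> H"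
  shows "x (\<alpha> + \<beta>) (t * u) \<in> H"
proof -
  let ?y = "xij \<alpha> \<beta>" and ?C = "\<lambda>i j. of_int (comm_const N \<alpha> \<beta> i j) :: 'a"
  have nz: "\<alpha> + \<beta> \<noteq> 0" using ab roots by (auto simp: root_system_def)
  have g: "?y 1 1 (?C 1 1 * (t * u)) \<otimes> (?y 2 1 (?C 2 1 * (t\<^sup>2 * u)) \<otimes>
      (?y 3 1 (?C 3 1 * (t ^ 3 * u)) \<otimes> ?y 3 2 (?C 3 2 * (t ^ 3 * u\<^sup>2)))) \<in> H"
    if "x \<alpha> t \<in> H" "x \<beta> u \<in> H" for t u
    using commutator_mem[OF ab(1,2) that] P
      commutator_xij[OF ab(1,2) nz, of "[(1, 1), (2, 1), (3, 1), (3, 2)]" t u] by simp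
  \<comment> \<open>Positive combinations of these index pairs have first entry at least 4.\<close>
  have c: "?y 3 1 r \<otimes> ?y 1 1 s = ?y 1 1 s \<otimes> ?y 3 1 r" "?y 3 1 r \<otimes> ?y 2 1 s = ?y 2 1 s \<otimes> ?y 3 1 r"
     "?y 3 2 r \<otimes> ?y 1 1 s = ?y 1 1 s \<otimes> ?y 3 2 r" "?y 3 2 r \<otimes> ?y 2 1 s = ?y 2 1 s \<otimes> ?y 3 2 r"
     "?y 3 2 r \<otimes> ?y 3 1 s = ?y 3 1 s \<otimes> ?y 3 2 r" for r s
    by (rule xij_comm[OF ab _ P]; force)+
  \<comment> \<open>The one remaining couple, \<open>(2, 1)\<close> and \<open>(1, 1)\<close>, has
    sum \<open>(3, 2)\<close>. \<open>K\<close> is the constant of that commutator, or 0 if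
    \<open>(2, 1)\<close> gives no root.\<close>
  obtain K where K: "?y 2 1 s \<otimes> ?y 1 1 r = ?y 3 2 (K * (s * r)) \<otimes> (?y 1 1 r \<otimes> ?y 2 1 s)" for r s
  proof (cases "real 2 *\<^sub>R \<alpha> + real 1 *\<^sub>R \<beta> \<in> \<Phi>")
    case False
    thus ?thesis using that[of 0] by (simp add: xij_def x_zero x_closed)
  next
    case True
    let ?g = "real 2 *\<^sub>R \<alpha> + real 1 *\<^sub>R \<beta>"
    have comb: "real m *\<^sub>R ?g + real n *\<^sub>R (\<alpha> + \<beta>) = real (m * 2 + n) *\<^sub>R \<alpha> + real (m + n) *\<^sub>R \<beta>" for m n
      by (simp add: algebra_simps)
    have "?g + (\<alpha> + \<beta>) \<noteq> 0" using combination_nonzero[OF ab, of 2 3] comb[of 1 1] by simp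
    moreover have "m = 1 \<and> n = 1" if mn: "m > 0" "n > 0" "real m *\<^sub>R ?g + real n *\<^sub>R (\<alpha> + \<beta>) \<in> \<Phi>" for m n
    proof -
      have "(m * 2 + n, m + n) \<in> {(1, 1), (2, 1), (3, 1), (3, 2)}"
        using P mn unfolding comb by blast
      thus ?thesis using mn by auto
    qed
    hence "{(m, n). m > 0 \<and> n > 0 \<and> real m *\<^sub>R ?g + real n *\<^sub>R (\<alpha> + \<beta>) \<in> \<Phi>} \<subseteq> set [(1, 1)]" by auto
    ultimately have *: "x ?g s \<otimes> x (\<alpha> + \<beta>) r \<otimes> inv (x ?g s) \<otimes> inv (x (\<alpha> + \<beta>) r) =
        xij ?g (\<alpha> + \<beta>) 1 1 (of_int (comm_const N ?g (\<alpha> + \<beta>) 1 1) * (s * r))" for r s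
      using commutator_xij[OF True ab(3), of "[(1, 1)]" s r] by simp
    have "xij ?g (\<alpha> + \<beta>) 1 1 = ?y 3 2"
      using comb[of 1 1] by (intro ext) (simp add: xij_def)
    with * have "x ?g s \<otimes> x (\<alpha> + \<beta>) r =
      ?y 3 2 (of_int (comm_const N ?g (\<alpha> + \<beta>) 1 1) * (s * r)) \<otimes> (x (\<alpha> + \<beta>) r \<otimes> x ?g s)" for r s
      using x_closed True ab by (intro commutator_eq_imp) simp_all
    moreover have "?y 2 1 s = x ?g s" "?y 1 1 r = x (\<alpha> + \<beta>) r" for r s
      using True ab by (simp_all add: xij_def)
    ultimately show ?thesis using that by metis
  qed
  have c': "?y 3 1 r \<otimes> (?y 1 1 s \<otimes> f) = ?y 1 1 s \<otimes> (?y 3 1 r \<otimes> f)"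
    "?y 3 2 r \<otimes> (?y 1 1 s \<otimes> f) = ?y 1 1 s \<otimes> (?y 3 2 r \<otimes> f)"
    "?y 3 2 r \<otimes> (?y 3 1 s \<otimes> f) = ?y 3 1 s \<otimes> (?y 3 2 r \<otimes> f)" if "f \<in> carrier G" for r s f
    using that by (intro commute_assoc xij_closed c; assumption)+
  \<comment> \<open>\<open>z\<close> collects the three commuting factors, so that parameters add
    componentwise.\<close>
  define z where "z = (\<lambda>a d k. ?y 1 1 a \<otimes> (?y 3 1 d \<otimes> ?y 3 2 k))"
  have z_add: "z a d k \<otimes> z a' d' k' = z (a + a') (d + d') (k + k')" for a d k a' d' k'
    unfolding z_def xij_add[symmetric] by (simp only: m_assoc m_closed xij_closed c')
  define a where "a = ?C 1 1 * (t * u)"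
  define d where "d = ?C 3 1 * (t ^ 3 * u)"
  define k where "k = K * ((?C 2 1 * (t\<^sup>2 * u)) * a)"
  have h: "z (2 * (?C 1 1 * (t * u))) (2 * (?C 3 1 * (t ^ 3 * u)))
      (K * ((?C 2 1 * (t\<^sup>2 * u)) * (?C 1 1 * (t * u)))) \<in> H" if H: "x \<alpha> t \<in> H" "x \<beta> u \<in> H" for t u
  proof -
    let ?a = "?y 1 1 (?C 1 1 * (t * u))" and ?b = "?y 2 1 (?C 2 1 * (t\<^sup>2 * u))"
      and ?d = "?y 3 1 (?C 3 1 * (t ^ 3 * u))" and ?e = "?y 3 2 (?C 3 2 * (t ^ 3 * u\<^sup>2))"
    have "?a \<otimes> (?b \<otimes> (?d \<otimes> ?e)) \<otimes> (?a \<otimes> (inv ?b \<otimes> (?d \<otimes> inv ?e))) \<in> H"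
      using H.m_closed[OF g[OF H] g[OF x_minus_mem[OF _ H(1)] x_minus_mem[OF _ H(2)]]] ab
      by (simp add: xij_minus[symmetric])
    also have "?a \<otimes> (?b \<otimes> (?d \<otimes> ?e)) \<otimes> (?a \<otimes> (inv ?b \<otimes> (?d \<otimes> inv ?e))) = ?a \<otimes> ?a \<otimes> ((?d \<otimes> ?d) \<otimes> ?y 3 2 (K * ((?C 2 1 * (t\<^sup>2 * u)) * (?C 1 1 * (t * u)))))"
      by (rule mult_inverse_twist_central[OF xij_closed xij_closed xij_closed xij_closed xij_closed
            K c(1) c(2) c(3) c(4) c(5) c(3) c(5)])
    finally show ?thesis unfolding z_def xij_add mult_2 .
  qed
  have h1: "z (2 * a) (2 * d) k \<in> H" using h[OF H] by (simp add: a_def d_def k_def)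
  \<comment> \<open>Replacing \<open>t\<close> by \<open>- 2 * t\<close> multiplies the parameter
    linear in \<open>t\<close> by -2 and the two cubic ones by -8.\<close>
  have "x \<alpha> (- 2 * t) \<in> H" using x_of_int_mem[OF ab(1) H(1), of "- 2"] by simp
  moreover have "2 * (?C 1 1 * (- 2 * t * u)) = - 4 * a" by (simp add: a_def algebra_simps)
  moreover have "2 * (?C 3 1 * ((- 2 * t) ^ 3 * u)) = - 16 * d"
    by (simp add: d_def power3_eq_cube algebra_simps)
  moreover have "K * (?C 2 1 * ((- 2 * t)\<^sup>2 * u) * (?C 1 1 * (- 2 * t * u))) = - 8 * k"
    by (simp add: k_def a_def power2_eq_square algebra_simps)
  ultimately have h2: "z (- 4 * a) (- 16 * d) (- 8 * k) \<in> H" using h[of "- 2 * t" u] H(2) by metis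
  \<comment> \<open>Three squarings give the eighth power, whose last two parameters cancel those of
    \<open>h2\<close>; of the first, \<open>16 - 4 = 12\<close> remains.\<close>
  have "z (4 * a) (4 * d) (2 * k) \<in> H" using H.m_closed[OF h1 h1] by (simp add: z_add)
  from H.m_closed[OF this this] have "z (8 * a) (8 * d) (4 * k) \<in> H" by (simp add: z_add)
  from H.m_closed[OF this this] have "z (16 * a) (16 * d) (8 * k) \<in> H" by (simp add: z_add)
  from H.m_closed[OF this h2] have "z (12 * a) 0 0 \<in> H" by (simp add: z_add)
  hence "x (\<alpha> + \<beta>) (of_int (12 * comm_const N \<alpha> \<beta> 1 1) * (t * u)) \<in> H"
    using ab by (simp add: z_def xij_zero a_def) (simp add: xij_def algebra_simps)
  from x_cancel_int_mem[OF ab(3) this not_dvd_constant[OF ab]] show ?thesis by simp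
qed

text \<open>The claim is symmetric in the two roots, so the one that is not longer may be taken
  first.\<close>

lemma x_mult_mem:
  assumes ab: "\<alpha> \<in> \<Phi>" "\<beta> \<in> \<Phi>" "\<alpha> + \<beta> \<in> \<Phi>" and H: "x \<alpha> t \<in> H" "x \<beta> u \<in> H"
  shows "x (\<alpha> + \<beta>) (t * u) \<in> H"
proof -
  have *: "x (\<alpha> + \<beta>) (t * u) \<in> H" if "\<alpha> \<in> \<Phi>" "\<beta> \<in> \<Phi>" "\<alpha> + \<beta> \<in> \<Phi>" "x \<alpha> t \<in> H" "x \<beta> u \<in> H"
    "\<alpha> \<bullet> \<alpha> \<le> \<beta> \<bullet> \<beta>" for \<alpha> \<beta> t u
    using rank_two_positive_combinations[OF roots that(1-3,6)] x_mult_mem_short[OF that(1-3) _ that(4,5)]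
      x_mult_mem_long[OF that(1-3) _ that(4,5)] by blast
  show ?thesis using *[of \<alpha> \<beta> t u] *[of \<beta> \<alpha> u t] ab H
    by (cases "\<alpha> \<bullet> \<alpha> \<le> \<beta> \<bullet> \<beta>") (auto simp: add.commute mult.commute)
qed

text \<open>On the way from a root of \<open>S\<close> to \<gamma>, each added root of
  \<open>S\<close> carries the parameter 1, so the parameter \<open>t\<close> is preserved.\<close>

lemma x_mem_of_positive_closure:
  assumes S: "S \<subseteq> \<Phi>" "positive_closure \<Phi> S = \<Phi>" and H: "\<And>\<beta>. \<beta> \<in> S \<Longrightarrow> x \<beta> 1 \<in> H \<and> x \<beta> t \<in> H"
    and g: "\<gamma> \<in> \<Phi>"
  shows "x \<gamma> t \<in> H"
  using roots S g
proof (induction rule: positive_closure_induct)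
  case (base \<beta>)
  thus ?case using H by simp
next
  case (step \<alpha> \<beta>)
  thus ?case using x_mult_mem[of \<alpha> \<beta> t 1] H S by auto
qed

text \<open>Splitting \<gamma> into two roots puts \<open>t\<close> on one summand and
  \<open>u\<close> on the other.\<close>

lemma x_mult_mem_all:
  assumes irr: "irreducible_root_system \<Phi>" "root_rank \<Phi> \<ge> 2"
    and t: "\<And>\<gamma>. \<gamma> \<in> \<Phi> \<Longrightarrow> x \<gamma> t \<in> H" and u: "\<And>\<gamma>. \<gamma> \<in> \<Phi> \<Longrightarrow> x \<gamma> u \<in> H" and g: "\<gamma> \<in> \<Phi>"
  shows "x \<gamma> (t * u) \<in> H"
  using root_sum_of_roots[OF irr g] x_mult_mem t u g by metis

end

end

section \<open>The Chevalley group over the residue field\<close>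

context
  fixes f :: "'p::prime_card mod_ring poly"
  assumes deg: "degree f > 0"
begin

lemma poly_residue_ring_simps:
  "carrier (poly_residue_ring f) = {t. degree t < degree f}"
  "t \<otimes>\<^bsub>poly_residue_ring f\<^esub> u = (t * u) mod f" "t \<oplus>\<^bsub>poly_residue_ring f\<^esub> u = t + u"
  "\<one>\<^bsub>poly_residue_ring f\<^esub> = 1" "\<zero>\<^bsub>poly_residue_ring f\<^esub> = 0"
  by (simp_all add: poly_residue_ring_def)

lemma mod_in_poly_residue_ring: "t mod f \<in> carrier (poly_residue_ring f)"
  using deg degree_mod_less[of f t] by (cases "f = 0") (auto simp: poly_residue_ring_simps)

lemma add_group_poly_residue_ring: "group (add_monoid (poly_residue_ring f))"
proof (rule groupI)
  fix t assume "t \<in> carrier (add_monoid (poly_residue_ring f))"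
  thus "\<exists>u\<in>carrier (add_monoid (poly_residue_ring f)).
      u \<otimes>\<^bsub>add_monoid (poly_residue_ring f)\<^esub> t = \<one>\<^bsub>add_monoid (poly_residue_ring f)\<^esub>"
    by (intro bexI[of _ "- t"]) (auto simp: poly_residue_ring_simps)
qed (auto simp: poly_residue_ring_simps deg degree_add_less)

lemma add_pow_poly_residue_ring_closed:
  "t \<in> carrier (poly_residue_ring f) \<Longrightarrow> add_pow (poly_residue_ring f) (k :: int) t \<in> carrier (poly_residue_ring f)"
  using group.int_pow_closed[OF add_group_poly_residue_ring, of t k] by (simp add: add_pow_def)

lemma add_pow_poly_residue_ring:
  assumes "t \<in> carrier (poly_residue_ring f)"
  shows "add_pow (poly_residue_ring f) (k :: int) t = of_int k * t"
proof -
  have pow: "add_pow (poly_residue_ring f) (n :: nat) t = of_nat n * t" for n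
    by (induction n) (simp_all add: add_pow_def nat_pow_def poly_residue_ring_simps algebra_simps)
  have mem: "of_nat n * t \<in> carrier (poly_residue_ring f)" for n
    using assms by (induction n) (simp_all add: poly_residue_ring_simps deg distrib_right degree_add_less)
  have inv: "\<ominus>\<^bsub>poly_residue_ring f\<^esub> u = - u" if "u \<in> carrier (poly_residue_ring f)" for u
    unfolding a_inv_def using that
    by (intro group.inv_equality[OF add_group_poly_residue_ring]) (auto simp: poly_residue_ring_simps)
  show ?thesis
    using add_pow_int_ge[of k "poly_residue_ring f" t] add_pow_int_lt[of k "poly_residue_ring f" t]
      inv[OF mem, of "nat (- k)"]
    by (cases "k < 0") (simp_all add: pow inv mem)
qed

lemma of_int_mult_mod: "(of_int k * t) mod f = of_int k * (t mod f)"
proof -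
  have "of_int k * (t mod f) \<in> carrier (poly_residue_ring f)"
    using add_pow_poly_residue_ring_closed[OF mod_in_poly_residue_ring, of k t] by (simp add: add_pow_poly_residue_ring mod_in_poly_residue_ring)
  hence "(of_int k * (t mod f)) mod f = of_int k * (t mod f)"
    by (intro mod_poly_less) (simp add: poly_residue_ring_simps)
  thus ?thesis by (simp add: mod_mult_right_eq)
qed

lemma mod_nat_pow: "(t mod f) [^]\<^bsub>poly_residue_ring f\<^esub> (n :: nat) = t ^ n mod f"
proof (induction n)
  case 0
  show ?case using deg by (simp add: nat_pow_def poly_residue_ring_simps mod_poly_less)
next
  case (Suc n)
  thus ?case by (simp add: nat_pow_def poly_residue_ring_simps mod_mult_eq mult.commute)
qed

text \<open>This identifies the parameter in the Steinberg relation with the reduction of the same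
  expression in polynomials, so that root elements can be indexed by all polynomials.\<close>

lemma commutator_parameter:
  "add_pow (poly_residue_ring f) (k :: int)
     ((t mod f) [^]\<^bsub>poly_residue_ring f\<^esub> (i :: nat) \<otimes>\<^bsub>poly_residue_ring f\<^esub> (u mod f) [^]\<^bsub>poly_residue_ring f\<^esub> (j :: nat))
   = (of_int k * (t ^ i * u ^ j)) mod f"
  unfolding mod_nat_pow poly_residue_ring_simps mod_mult_eq
  by (simp add: add_pow_poly_residue_ring mod_in_poly_residue_ring of_int_mult_mod)

lemma steinberg_system_chevalley_group:
  fixes \<Phi> :: "'v::euclidean_space set"
  assumes rs: "root_system \<Phi>" and N: "chevalley_constants \<Phi> N" and card: "CARD('p) > 3"
  shows "steinberg_system (chevalley_group \<Phi> N (poly_residue_ring f)) \<Phi> N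
    (\<lambda>\<alpha> t. root_elem \<Phi> N (poly_residue_ring f) \<alpha> (t mod f)) CARD('p)"
proof -
  let ?F = "poly_residue_ring f"
  let ?X = "\<Phi> \<times> carrier ?F" and ?R = "steinberg_relations \<Phi> N ?F"
  let ?G = "presented_group ?X ?R" and ?x = "\<lambda>\<alpha> t. word_class ?X ?R (xw \<alpha> (t mod f))"
  have xw: "xw \<alpha> (t mod f) \<in> gwords ?X" if "\<alpha> \<in> \<Phi>" for \<alpha> t
    using that mod_in_poly_residue_ring by (simp add: xw_def)
  interpret group ?G by (rule group_presented_group)
  have add: "?x \<alpha> t \<otimes>\<^bsub>?G\<^esub> ?x \<alpha> u = ?x \<alpha> (t + u)" if "\<alpha> \<in> \<Phi>" for \<alpha> t u
  proof -
    have "(xw \<alpha> (t mod f) @ xw \<alpha> (u mod f), xw \<alpha> (t mod f \<oplus>\<^bsub>?F\<^esub> u mod f)) \<in> ?R"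
      by (intro steinberg_relations.additive that mod_in_poly_residue_ring)
    hence "(xw \<alpha> (t mod f) @ xw \<alpha> (u mod f), xw \<alpha> ((t + u) mod f)) \<in> ?R"
      by (simp add: poly_residue_ring_simps poly_mod_add_left)
    hence "word_class ?X ?R (xw \<alpha> (t mod f) @ xw \<alpha> (u mod f)) = ?x \<alpha> (t + u)"
      by (rule word_class_relation) (simp_all add: xw that)
    thus ?thesis using xw[OF that] by (simp add: presented_group_mult)
  qed
  have comm: "?x \<alpha> t \<otimes>\<^bsub>?G\<^esub> ?x \<beta> u \<otimes>\<^bsub>?G\<^esub> inv\<^bsub>?G\<^esub> ?x \<alpha> t \<otimes>\<^bsub>?G\<^esub> inv\<^bsub>?G\<^esub> ?x \<beta> u =
      foldr (\<lambda>(i, j) g. ?x (real i *\<^sub>R \<alpha> + real j *\<^sub>R \<beta>) (of_int (comm_const N \<alpha> \<beta> i j) * (t ^ i * u ^ j)) \<otimes>\<^bsub>?G\<^esub> g)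
        ijs \<one>\<^bsub>?G\<^esub>"
    if ab: "\<alpha> \<in> \<Phi>" "\<beta> \<in> \<Phi>" "\<alpha> + \<beta> \<noteq> 0" and ijs: "distinct ijs" "sorted (map (\<lambda>(i, j). i + j) ijs)"
      "set ijs = {(i, j). i > 0 \<and> j > 0 \<and> real i *\<^sub>R \<alpha> + real j *\<^sub>R \<beta> \<in> \<Phi>}" for \<alpha> \<beta> t u ijs
  proof -
    let ?h = "\<lambda>(i, j). xw (real i *\<^sub>R \<alpha> + real j *\<^sub>R \<beta>) ((of_int (comm_const N \<alpha> \<beta> i j) * (t ^ i * u ^ j)) mod f)"
    have "(wcomm (xw \<alpha> (t mod f)) (xw \<beta> (u mod f)), concat (map ?h ijs)) \<in> ?R"
      using steinberg_relations.commutator[OF ab mod_in_poly_residue_ring mod_in_poly_residue_ring ijs, of t u N]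
      unfolding commutator_parameter .
    \<comment> \<open>The induction runs over lists of index pairs from \<open>ijs\<close>, since
      only those are known to give roots and hence valid words.\<close>
    moreover have fold: "concat (map ?h L) \<in> gwords ?X \<and> word_class ?X ?R (concat (map ?h L)) =
      foldr (\<lambda>(i, j) g. ?x (real i *\<^sub>R \<alpha> + real j *\<^sub>R \<beta>) (of_int (comm_const N \<alpha> \<beta> i j) * (t ^ i * u ^ j)) \<otimes>\<^bsub>?G\<^esub> g)
        L \<one>\<^bsub>?G\<^esub>" if "set L \<subseteq> set ijs" for L
      using that
    proof (induction L)
      case Nil
      show ?case by (simp add: presented_group_one)
    next
      case (Cons q L)
      obtain i j where q: "q = (i, j)" by (cases q)
      have "real i *\<^sub>R \<alpha> + real j *\<^sub>R \<beta> \<in> \<Phi>" using Cons.prems ijs(3) q by auto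
      from xw[OF this, of "of_int (comm_const N \<alpha> \<beta> i j) * (t ^ i * u ^ j)"] show ?case
        using Cons by (simp add: q presented_group_mult[symmetric])
    qed
    ultimately have "word_class ?X ?R (wcomm (xw \<alpha> (t mod f)) (xw \<beta> (u mod f))) =
        word_class ?X ?R (concat (map ?h ijs))"
      using xw ab by (intro word_class_relation) (auto simp: wcomm_def)
    moreover have "word_class ?X ?R (wcomm (xw \<alpha> (t mod f)) (xw \<beta> (u mod f))) =
        ?x \<alpha> t \<otimes>\<^bsub>?G\<^esub> ?x \<beta> u \<otimes>\<^bsub>?G\<^esub> inv\<^bsub>?G\<^esub> ?x \<alpha> t \<otimes>\<^bsub>?G\<^esub> inv\<^bsub>?G\<^esub> ?x \<beta> u"
      using xw ab by (simp add: wcomm_def presented_group_mult presented_group_inv)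
    ultimately show ?thesis using fold by simp
  qed
  show ?thesis
    unfolding chevalley_group_def root_elem_def
  proof (intro steinberg_system.intro steinberg_system_axioms.intro group_axioms rs N card add comm)
    show "prime CARD('p)" by (rule prime_card)
    show "of_nat CARD('p) = (0 :: 'p mod_ring poly)" by (simp add: of_nat_poly)
    show "?x \<alpha> t \<in> carrier ?G" if "\<alpha> \<in> \<Phi>" for \<alpha> t using xw[OF that] by simp
  qed
qed

end

theorem theorem3p8:
  fixes \<Phi> S :: "'v::euclidean_space set"
    and N :: "'v \<Rightarrow> 'v \<Rightarrow> int"
    and f :: "'p::prime_card mod_ring poly"
    and m :: nat
  assumes "CARD('p) > 3"
    and "irreducible f" and "degree f = m"
    and "irreducible_root_system \<Phi>" and "root_rank \<Phi> \<ge> 2"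
    and "chevalley_constants \<Phi> N"
    and "S \<subseteq> \<Phi>" and "card S = root_rank \<Phi> + 1"
    and "positive_closure \<Phi> S = \<Phi>"
  shows "X_sub \<Phi> N f S = carrier (chevalley_group \<Phi> N (poly_residue_ring f))"
proof -
  let ?F = "poly_residue_ring f" and ?H = "X_sub \<Phi> N f S"
  let ?G = "chevalley_group \<Phi> N ?F" and ?x = "\<lambda>\<alpha> t. root_elem \<Phi> N (poly_residue_ring f) \<alpha> (t mod f)"
  have deg: "degree f > 0"
    using assms(2) is_unit_iff_degree[of f] by (auto simp: irreducible_def)
  have rs: "root_system \<Phi>" using assms(4) by (simp add: irreducible_root_system_def)
  interpret steinberg_system ?G \<Phi> N ?x "CARD('p)"
    using steinberg_system_chevalley_group[OF deg rs assms(6,1)] .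
  have x: "?x \<alpha> t = root_elem \<Phi> N ?F \<alpha> t" if "t \<in> carrier ?F" for \<alpha> t
    using that by (simp add: poly_residue_ring_def mod_poly_less)
  have H: "subgroup ?H ?G"
    unfolding X_sub_def
  proof (rule generate_is_subgroup, safe)
    fix \<alpha> t assume "\<alpha> \<in> S" "t \<in> carrier ?F"
    thus "root_elem \<Phi> N ?F \<alpha> t \<in> carrier ?G" using x_closed[of \<alpha> t] x assms(7) by auto
  qed
  have S: "?x \<alpha> t \<in> ?H" if "\<alpha> \<in> S" "degree t \<le> 1" for \<alpha> t
  proof -
    have "degree (t mod f) < degree f" using mod_in_poly_residue_ring[OF deg, of t] by (simp add: poly_residue_ring_def)
    \<comment> \<open>If \<open>f\<close> is linear the residue is a constant; otherwise a
      \<open>t\<close> of degree at most 1 is its own residue.\<close>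
    hence "degree (t mod f) \<le> 1" using that mod_poly_less[of t f] by (cases "degree f > 1") auto
    with that(1) mod_in_poly_residue_ring[OF deg, of t] show ?thesis unfolding X_sub_def
      by (intro generate.incl CollectI exI[of _ \<alpha>] exI[of _ "t mod f"] conjI) simp_all
  qed
  note closure = x_mem_of_positive_closure[OF H assms(7,9)]
  have one: "?x \<gamma> 1 \<in> ?H" and X: "?x \<gamma> [:0, 1:] \<in> ?H" if "\<gamma> \<in> \<Phi>" for \<gamma>
    using closure[OF _ that] S by simp_all
  \<comment> \<open>Horner's scheme: \<open>pCons a q\<close> is the constant \<open>a\<close> plus
    the indeterminate times \<open>q\<close>.\<close>
  have all: "?x \<gamma> t \<in> ?H" if "\<gamma> \<in> \<Phi>" for \<gamma> t
    using that
  proof (induction t arbitrary: \<gamma>)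
    case 0
    thus ?case using x_of_int_mem[OF H _ one, of \<gamma> 0] by simp
  next
    case (pCons a q)
    \<comment> \<open>A constant is an integer multiple of 1, since its coefficient lies in the
      prime field.\<close>
    have "of_int (to_int_mod_ring a) * 1 = [:a:]"
      by (simp add: of_int_poly of_int_of_int_mod_ring)
    hence "?x \<gamma> [:a:] \<in> ?H" using x_of_int_mem[OF H pCons.prems one[OF pCons.prems], of "to_int_mod_ring a"] by simp
    moreover have "?x \<gamma> ([:0, 1:] * q) \<in> ?H"
      by (rule x_mult_mem_all[OF H assms(4,5) X pCons.IH pCons.prems])
    ultimately have "?x \<gamma> ([:a:] + [:0, 1:] * q) \<in> ?H" by (rule x_add_mem[OF H pCons.prems])
    thus ?case by simp
  qed
  have "carrier ?G \<subseteq> ?H"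
    unfolding chevalley_group_def
  proof (rule presented_group_subset_subgroup)
    show "subgroup ?H (presented_group (\<Phi> \<times> carrier ?F) (steinberg_relations \<Phi> N ?F))"
      using H by (simp add: chevalley_group_def)
  next
    fix q assume "q \<in> \<Phi> \<times> carrier ?F"
    then obtain \<alpha> t where "q = (\<alpha>, t)" "\<alpha> \<in> \<Phi>" "t \<in> carrier ?F" by auto
    thus "word_class (\<Phi> \<times> carrier ?F) (steinberg_relations \<Phi> N ?F) [(q, True)] \<in> ?H"
      using all[of \<alpha> t] x[of t \<alpha>] by (simp add: root_elem_def xw_def)
  qed
  thus ?thesis using subgroup.subset[OF H] by blast
qed

end
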